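(* Let $b\ge 3$ be an integer and let $D\subset\{0,1,\dots,b-1\}$ satisfy $0\in D$ and $2\le |D|<b$. Let $\mathcal C$ be the integer Cantor set with base $b$ and digit set $D$, and let $k_1<k_2<\cdots$ be its increasing enumeration. Let $\ell\ge1$ be an integer. Then for every set $A$ of integers of positive upper Banach density there is a set $B$ of positive integers, of positive lower Banach density, such that for every $n\in B$ the set $A$ contains an $(\ell+1)$-term arithmetic progression with step size $k_n$, i.e. there is an integer $a$ with $a,\ a+k_n,\ \dots,\ a+\ell k_n\in A$.
   Context: The integer Cantor set with base $b$ and digit set $D$ is $$\mathcal C=\Bigl\{\sum_{j=0}^{k} d_j b^j : k\in\mathbb N,\ d_j\in D\Bigr\}.$$ The upper Banach density of a set $A$ of integers is $\lim_{N\to\infty}\sup_{M}\frac{|A\cap[M+1,M+N]|}{N}$, where $M$ ranges over the integers. The lower Banach density of a set $B$ of positive integers is $\lim_{N\to\infty}\inf_{M\ge 0}\frac{|B\cap[M+1,M+N]|}{N}$. *)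

theory Defs
  imports Complex_Main
begin

definition integer_cantor_set :: "nat \<Rightarrow> nat set \<Rightarrow> nat set" where
  "integer_cantor_set b D = {\<Sum>j\<le>k. d j * b ^ j | (k::nat) (d::nat \<Rightarrow> nat). \<forall>j\<le>k. d j \<in> D}"

text \<open>
  In both densities below the limit exists for every set: the number of elements of a set in
  an interval of length N has a supremum that is subadditive in N and an infimum that is
  superadditive in N, so Fekete's lemma applies. The value at N = 0 is irrelevant (it is 0).
\<close>

definition upper_Banach_density :: "int set \<Rightarrow> real" where
  "upper_Banach_density A =
     lim (\<lambda>N::nat. SUP M::int. real (card (A \<inter> {M + 1..M + int N})) / real N)"

definition lower_Banach_density :: "nat set \<Rightarrow> real" where
  "lower_Banach_density B =
     lim (\<lambda>N::nat. INF M::nat. real (card (B \<inter> {M + 1..M + N})) / real N)"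

end

theory Submission
  imports Defs "HOL-Library.FuncSet"
begin

text \<open>The steps of progressions in \<open>A\<close> form an IP* set: they meet the set of finite sums of every
  sequence \<open>x\<^sub>1, x\<^sub>2, \<dots>\<close>, by the density Hales--Jewett theorem applied to the words \<open>w\<close> with
  \<open>a + \<Sum> w\<^sub>j x\<^sub>j \<in> A\<close>. Let \<open>C\<^sub>N\<close> consist of the elements of the Cantor set with \<open>N\<close> digits. An IP* set
  cannot, for every \<open>N\<close>, miss some translate \<open>b\<^sup>N c + C\<^sub>N\<close> with \<open>c\<close> in the Cantor set, since sparse
  choices of the \<open>b\<^sup>N c\<close> have disjoint digit supports. So for some \<open>N\<close> it meets all of these blocks, which
  is syndeticity of the set of indices.

  The density Hales--Jewett theorem is proved along the lines of Dodos, Kanellopoulos and Tyros, by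
  induction on the alphabet. Instead of iterating density increments we work just below the critical
  density, where every large subspace is automatically almost as dense as the whole space.\<close>

section \<open>Words and templates\<close>

text \<open>The Cantor set has density zero, so the step of a progression must be forced into a very
  thin set, and the conclusion counts indices \<open>n\<close> rather than values
  \<open>k n\<close>. Translates of a fixed level serve both purposes: those with high part in the
  Cantor set occupy runs of consecutive indices of bounded length, and sums of numbers with
  separated digits never carry.

  In the density step, let \<open>A\<close> contain no line over \<open>k + 1\<close> letters. Then
  \<open>A\<close> misses every word that contains \<open>k\<close> and all of whose replacements of
  \<open>k\<close> by a smaller letter lie in \<open>A\<close>. If such words have positive
  proportion, the mass of \<open>A\<close> is squeezed into the other words. The obstacle is to have
  that proportion on a whole subspace: the theorem for \<open>k\<close> letters yields only one
  variable word that works for many fibres, and Graham--Rothschild turns one into all. The event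
  that the replacement of \<open>k\<close> by \<open>i\<close> lies in \<open>A\<close> is
  insensitive to exchanging \<open>k\<close> and \<open>i\<close>, so such sets can be controlled by
  words over \<open>k\<close> letters: the induction hypothesis tiles them by subspaces up to a
  small error, and on one tile \<open>A\<close> would exceed the critical density.\<close>

definition words :: "nat \<Rightarrow> nat \<Rightarrow> nat list set" where
  "words k n = {w. set w \<subseteq> {..<k} \<and> length w = n}"

lemma finite_words [simp]: "finite (words k n)"
  unfolding words_def by (rule finite_lists_length_eq) simp

lemma card_words: "card (words k n) = k ^ n"
  unfolding words_def by (simp add: card_lists_length_eq)

lemma words_length: "w \<in> words k n \<Longrightarrow> length w = n"
  by (simp add: words_def)

lemma words_nth: "w \<in> words k n \<Longrightarrow> i < n \<Longrightarrow> w ! i < k"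
  unfolding words_def using nth_mem by blast

lemma words_0 [simp]: "words k 0 = {[]}"
  by (auto simp: words_def)

lemma words_mono: "k \<le> k' \<Longrightarrow> words k n \<subseteq> words k' n"
  by (auto simp: words_def)

lemma Nil_words [simp]: "[] \<in> words k n \<longleftrightarrow> n = 0"
  by (auto simp: words_def)

lemma Cons_words [simp]: "a # w \<in> words k (Suc n) \<longleftrightarrow> a < k \<and> w \<in> words k n"
  by (auto simp: words_def)

lemma append_words: "x \<in> words k m \<Longrightarrow> y \<in> words k n \<Longrightarrow> x @ y \<in> words k (m + n)"
  by (auto simp: words_def)

lemma words_Suc_cases:
  assumes "w \<in> words k (Suc n)"
  obtains a x where "w = a # x" "a < k" "x \<in> words k n"
  using assms by (cases w) (auto simp: words_def)

lemma words_append_cases: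
  assumes "w \<in> words k (m + n)"
  obtains x y where "w = x @ y" "x \<in> words k m" "y \<in> words k n"
proof
  show "w = take m w @ drop m w" by simp
  show "take m w \<in> words k m" "drop m w \<in> words k n"
    using assms by (auto simp: words_def dest: in_set_takeD in_set_dropD)
qed

lemma singleton_words: "w \<in> words k 1 \<longleftrightarrow> (\<exists>i<k. w = [i])"
  by (auto simp: words_def length_Suc_conv)

lemma replicate_words: "a < k \<Longrightarrow> replicate n a \<in> words k n"
  by (auto simp: words_def)

lemma sum_words_append:
  fixes f :: "nat list \<Rightarrow> real"
  shows "(\<Sum>w\<in>words k (m + n). f w) = (\<Sum>x\<in>words k m. \<Sum>y\<in>words k n. f (x @ y))"
proof -
  have "(\<Sum>x\<in>words k m. \<Sum>y\<in>words k n. f (x @ y))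
      = (\<Sum>(x, y)\<in>words k m \<times> words k n. f (x @ y))"
    by (simp add: sum.cartesian_product)
  also have "\<dots> = (\<Sum>w\<in>words k (m + n). f w)"
    by (rule sum.reindex_bij_witness[where i = "\<lambda>w. (take m w, drop m w)" and j = "\<lambda>(x, y). x @ y"])
       (auto simp: words_def dest: in_set_takeD in_set_dropD)
  finally show ?thesis by simp
qed

lemma sum_words_Suc:
  fixes f :: "nat list \<Rightarrow> real"
  shows "(\<Sum>w\<in>words k (Suc n). f w) = (\<Sum>a<k. \<Sum>y\<in>words k n. f (a # y))"
proof -
  have "words k 1 = (\<lambda>a. [a]) ` {..<k}"
    unfolding set_eq_iff singleton_words by blast
  then have "(\<Sum>x\<in>words k 1. \<Sum>y\<in>words k n. f (x @ y)) = (\<Sum>a<k. \<Sum>y\<in>words k n. f (a # y))"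
    by (simp add: sum.reindex inj_on_def)
  then show ?thesis
    using sum_words_append[of f k 1 n] by simp
qed

subsection \<open>Averages over words\<close>

definition avg :: "nat \<Rightarrow> nat \<Rightarrow> (nat list \<Rightarrow> real) \<Rightarrow> real" where
  "avg k n f = (\<Sum>w\<in>words k n. f w) / real k ^ n"

lemma avg_append: "avg k (m + n) f = avg k m (\<lambda>x. avg k n (\<lambda>y. f (x @ y)))"
  unfolding avg_def sum_words_append by (simp add: sum_divide_distrib power_add mult.commute)

lemma avg_swap:
  "avg k m (\<lambda>x. avg k' n (\<lambda>y. f x y)) = avg k' n (\<lambda>y. avg k m (\<lambda>x. f x y))"
  unfolding avg_def sum_divide_distrib[symmetric]
  by (subst sum.swap) (simp add: mult.commute)

lemma avg_const [simp]: "k > 0 \<Longrightarrow> avg k n (\<lambda>_. c) = c"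
  by (simp add: avg_def card_words)

lemma avg_mono: "(\<And>w. w \<in> words k n \<Longrightarrow> f w \<le> g w) \<Longrightarrow> avg k n f \<le> avg k n g"
  unfolding avg_def by (intro divide_right_mono sum_mono) auto

lemma avg_cong: "(\<And>w. w \<in> words k n \<Longrightarrow> f w = g w) \<Longrightarrow> avg k n f = avg k n g"
  unfolding avg_def by (auto intro: arg_cong[where f = "\<lambda>x. x / _"] sum.cong)

lemma avg_add: "avg k n (\<lambda>w. f w + g w) = avg k n f + avg k n g"
  unfolding avg_def by (simp add: sum.distrib add_divide_distrib)

lemma avg_diff: "avg k n (\<lambda>w. f w - g w) = avg k n f - avg k n g"
  unfolding avg_def by (simp add: sum_subtractf diff_divide_distrib)

lemma avg_cmult: "avg k n (\<lambda>w. c * f w) = c * avg k n f"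
  unfolding avg_def by (simp add: sum_distrib_left[symmetric])

lemma avg_sum: "avg k n (\<lambda>w. \<Sum>i\<in>I. f i w) = (\<Sum>i\<in>I. avg k n (f i))"
  unfolding avg_def by (subst sum.swap) (simp add: sum_divide_distrib)

lemma avg_le_const: "k > 0 \<Longrightarrow> (\<And>w. w \<in> words k n \<Longrightarrow> f w \<le> c) \<Longrightarrow> avg k n f \<le> c"
  using avg_mono[of k n f "\<lambda>_. c"] by simp

lemma avg_ge_const: "k > 0 \<Longrightarrow> (\<And>w. w \<in> words k n \<Longrightarrow> c \<le> f w) \<Longrightarrow> c \<le> avg k n f"
  using avg_mono[of k n "\<lambda>_. c" f] by simp

lemma avg_exists_ge:
  assumes "k > 0" "c \<le> avg k n f"
  obtains w where "w \<in> words k n" "c \<le> f w"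
proof -
  have "\<exists>w\<in>words k n. c \<le> f w"
  proof (rule ccontr)
    assume "\<not> ?thesis"
    then have "(\<Sum>w\<in>words k n. f w) < (\<Sum>w\<in>words k n. c)"
      using replicate_words[of 0 k n] assms(1)
      by (intro sum_strict_mono) (auto simp: not_le)
    then have "avg k n f < avg k n (\<lambda>_. c)"
      unfolding avg_def using assms(1) by (intro divide_strict_right_mono) auto
    then show False
      using assms by simp
  qed
  then show ?thesis using that by blast
qed

text \<open>Reverse Markov inequality: \<open>f\<close> is at most 1 on the event and below
  \<open>\<epsilon>\<close> off it.\<close>

lemma avg_markov:
  assumes "k > 0" "\<And>w. w \<in> words k n \<Longrightarrow> f w \<le> 1" "\<epsilon> \<ge> 0"
  shows "avg k n f - \<epsilon> \<le> avg k n (\<lambda>w. of_bool (\<epsilon> \<le> f w))"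
proof -
  have "avg k n f \<le> avg k n (\<lambda>w. of_bool (\<epsilon> \<le> f w) + \<epsilon>)"
    using assms by (intro avg_mono) (auto simp: of_bool_def add_increasing2)
  then show ?thesis
    using assms(1) by (simp add: avg_add)
qed

lemma avg_pigeonhole:
  assumes "k > 0" "finite L" "\<delta> > 0" "\<delta> \<le> avg k n (\<lambda>w. of_bool (\<exists>t\<in>L. Q t w))"
  obtains t where "t \<in> L" "\<delta> / real (card L) \<le> avg k n (\<lambda>w. of_bool (Q t w))"
proof -
  have "\<exists>t\<in>L. \<delta> / real (card L) \<le> avg k n (\<lambda>w. of_bool (Q t w))"
  proof (rule ccontr)
    assume neg: "\<not> ?thesis"
    have le: "of_bool (\<exists>t\<in>L. Q t w) \<le> (\<Sum>t\<in>L. of_bool (Q t w) :: real)" for w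
    proof (cases "\<exists>t\<in>L. Q t w")
      case True
      then obtain t where t: "t \<in> L" "Q t w" by blast
      have "of_bool (Q t w) \<le> (\<Sum>t\<in>L. of_bool (Q t w) :: real)"
        using t assms(2) by (intro member_le_sum) auto
      then show ?thesis using t by simp
    qed (simp add: sum_nonneg)
    have "\<delta> \<le> avg k n (\<lambda>w. \<Sum>t\<in>L. of_bool (Q t w))"
      using assms(4) avg_mono[of k n "\<lambda>w. of_bool (\<exists>t\<in>L. Q t w)", OF le] by linarith
    then have *: "\<delta> \<le> (\<Sum>t\<in>L. avg k n (\<lambda>w. of_bool (Q t w)))"
      by (simp add: avg_sum)
    then have ne: "L \<noteq> {}" using assms(3) by auto
    have "(\<Sum>t\<in>L. avg k n (\<lambda>w. of_bool (Q t w))) < (\<Sum>t\<in>L. \<delta> / real (card L))"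
      using neg ne assms(2) by (intro sum_strict_mono) (auto simp: not_le)
    then show False using * ne assms(2) by simp
  qed
  then show ?thesis using that by blast
qed

subsection \<open>Templates of combinatorial subspaces\<close>

text \<open>In a template, \<open>Inl a\<close> is a fixed letter and \<open>Inr i\<close> the \<open>i\<close>-th variable. A template with \<open>m\<close> variables,
  each of which occurs, is an \<open>m\<close>-dimensional combinatorial subspace, and a line if \<open>m = 1\<close>.\<close>

definition template :: "nat \<Rightarrow> nat \<Rightarrow> nat \<Rightarrow> (nat + nat) list set" where
  "template k m n = {t. length t = n \<and> set t \<subseteq> Inl ` {..<k} \<union> Inr ` {..<m} \<and> Inr ` {..<m} \<subseteq> set t}"

definition inst :: "nat list \<Rightarrow> (nat + nat) list \<Rightarrow> nat list" where
  "inst z t = map (case_sum (\<lambda>a. a) (\<lambda>i. z ! i)) t"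

definition compose :: "(nat + nat) list \<Rightarrow> (nat + nat) list \<Rightarrow> (nat + nat) list" where
  "compose f t = map (case_sum Inl (\<lambda>i. f ! i)) t"

definition shift :: "nat \<Rightarrow> (nat + nat) list \<Rightarrow> (nat + nat) list" where
  "shift m t = map (map_sum id ((+) m)) t"

lemma finite_template: "finite (template k m n)"
proof -
  have "template k m n \<subseteq> {t. set t \<subseteq> Inl ` {..<k} \<union> Inr ` {..<m} \<and> length t = n}"
    by (auto simp: template_def)
  then show ?thesis
    by (rule finite_subset) (rule finite_lists_length_eq, simp)
qed

lemma template_length: "t \<in> template k m n \<Longrightarrow> length t = n"
  by (simp add: template_def)

lemma template_elem: "t \<in> template k m n \<Longrightarrow> s \<in> set t \<Longrightarrow> (\<exists>a<k. s = Inl a) \<or> (\<exists>i<m. s = Inr i)"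
  by (auto simp: template_def)

lemma template_var: "t \<in> template k m n \<Longrightarrow> i < m \<Longrightarrow> Inr i \<in> set t"
  by (auto simp: template_def)

lemma templateI:
  assumes "length t = n" "\<And>s. s \<in> set t \<Longrightarrow> (\<exists>a<k. s = Inl a) \<or> (\<exists>i<m. s = Inr i)"
    "\<And>i. i < m \<Longrightarrow> Inr i \<in> set t"
  shows "t \<in> template k m n"
proof -
  have "set t \<subseteq> Inl ` {..<k} \<union> Inr ` {..<m}"
    using assms(2) by auto
  then show ?thesis
    using assms(1,3) by (auto simp: template_def)
qed

lemma template_mono: "k \<le> k' \<Longrightarrow> template k m n \<subseteq> template k' m n"
  unfolding template_def using image_mono[of "{..<k}" "{..<k'}" Inl] by auto

lemma length_inst [simp]: "length (inst z t) = length t"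
  by (simp add: inst_def)

lemma inst_append: "inst z (s @ t) = inst z s @ inst z t"
  by (simp add: inst_def)

lemma inst_Inl [simp]: "inst z (map Inl w) = w"
  by (simp add: inst_def comp_def)

lemma inst_words:
  assumes "t \<in> template k m n" "z \<in> words k m"
  shows "inst z t \<in> words k n"
proof -
  have "case_sum (\<lambda>a. a) (\<lambda>i. z ! i) s < k" if "s \<in> set t" for s
    using template_elem[OF assms(1) that] words_nth[OF assms(2)] by auto
  then show ?thesis
    using template_length[OF assms(1)] by (auto simp: words_def inst_def)
qed

text \<open>Templates over \<open>k\<close> letters are often evaluated at words over
  \<open>Suc k\<close>. Their fixed letters are below \<open>k\<close>, so a letter \<open>k\<close>
  in the result can only come from a variable; this lets \<open>inst [k] t\<close> encode a line as
  a word.\<close>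

lemma inst_words_le: "t \<in> template k m n \<Longrightarrow> k \<le> k' \<Longrightarrow> z \<in> words k' m \<Longrightarrow> inst z t \<in> words k' n"
  using inst_words template_mono by blast

lemma letter_in_inst:
  assumes "t \<in> template k m n" "z \<in> words k' m" "a \<in> set z"
  shows "a \<in> set (inst z t)"
proof -
  obtain i where i: "i < m" "z ! i = a"
    using assms(2,3) by (auto simp: in_set_conv_nth words_length)
  have "case_sum (\<lambda>a. a) (\<lambda>i. z ! i) (Inr i) \<in> set (inst z t)"
    unfolding inst_def set_map using template_var[OF assms(1) i(1)] by (rule imageI)
  then show ?thesis using i by simp
qed

lemma inst_inj:
  assumes "t \<in> template k m n" "inst z t = inst z' t" "length z = m" "length z' = m"
  shows "z = z'"
proof (rule nth_equalityI)
  fix i assume "i < length z"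
  then have i: "Inr i \<in> set t" using assms template_var by blast
  have "case_sum (\<lambda>a. a) (\<lambda>i. z ! i) s = case_sum (\<lambda>a. a) (\<lambda>i. z' ! i) s" if "s \<in> set t" for s
    using assms(2) that by (auto simp: inst_def)
  from this[OF i] show "z ! i = z' ! i" by simp
qed (use assms in simp)

lemma length_compose [simp]: "length (compose f t) = length t"
  by (simp add: compose_def)

lemma inst_compose:
  assumes "t \<in> template k m n" "length f = m"
  shows "inst z (compose f t) = inst (inst z f) t"
proof -
  have "case_sum (\<lambda>a. a) ((!) z) (case_sum Inl ((!) f) s) = case_sum (\<lambda>a. a) ((!) (inst z f)) s"
    if "s \<in> set t" for s
    using template_elem[OF assms(1) that] assms(2) by (auto simp: inst_def)
  then show ?thesis
    unfolding inst_def[of _ "compose f t"] inst_def[of _ t] unfolding compose_def by simp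
qed

lemma compose_template:
  assumes "f \<in> template k m' m" "t \<in> template k m n"
  shows "compose f t \<in> template k m' n"
proof (rule templateI)
  show "length (compose f t) = n" using assms template_length by auto
next
  fix s assume "s \<in> set (compose f t)"
  then obtain u where u: "u \<in> set t" "s = case_sum Inl (\<lambda>i. f ! i) u"
    by (auto simp: compose_def)
  show "(\<exists>a<k. s = Inl a) \<or> (\<exists>i<m'. s = Inr i)"
    using template_elem[OF assms(2) u(1)]
  proof
    assume "\<exists>i<m. u = Inr i"
    then have "s \<in> set f" using u assms(1) by (auto simp: template_length)
    then show ?thesis using template_elem[OF assms(1)] by blast
  qed (use u in auto)
next
  fix i assume "i < m'"
  then obtain j where j: "j < m" "f ! j = Inr i"
    using template_var[OF assms(1)] template_length[OF assms(1)] by (metis in_set_conv_nth)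
  have "case_sum Inl (\<lambda>i. f ! i) (Inr j) \<in> set (compose f t)"
    unfolding compose_def set_map using template_var[OF assms(2) j(1)] by (rule imageI)
  then show "Inr i \<in> set (compose f t)" using j by simp
qed

lemma Inl_append_template: "x \<in> words k n \<Longrightarrow> t \<in> template k m n' \<Longrightarrow> map Inl x @ t \<in> template k m (n + n')"
proof (rule templateI)
  show "length (map Inl x @ t) = n + n'" if "x \<in> words k n" "t \<in> template k m n'"
    using that by (simp add: words_length template_length)
next
  fix s assume x: "x \<in> words k n" and t: "t \<in> template k m n'" and s: "s \<in> set (map Inl x @ t)"
  then consider a where "a \<in> set x" "s = Inl a" | "s \<in> set t" by auto
  then show "(\<exists>a<k. s = Inl a) \<or> (\<exists>i<m. s = Inr i)"
    using x template_elem[OF t] by cases (auto simp: words_def)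
next
  show "Inr i \<in> set (map Inl x @ t)" if "t \<in> template k m n'" "i < m" for i
    using template_var[OF that] by simp
qed

lemma append_Inl_template: "x \<in> words k n \<Longrightarrow> t \<in> template k m n' \<Longrightarrow> t @ map Inl x \<in> template k m (n' + n)"
proof (rule templateI)
  show "length (t @ map Inl x) = n' + n" if "x \<in> words k n" "t \<in> template k m n'"
    using that by (simp add: words_length template_length)
next
  fix s assume x: "x \<in> words k n" and t: "t \<in> template k m n'" and s: "s \<in> set (t @ map Inl x)"
  then consider a where "a \<in> set x" "s = Inl a" | "s \<in> set t" by auto
  then show "(\<exists>a<k. s = Inl a) \<or> (\<exists>i<m. s = Inr i)"
    using x template_elem[OF t] by cases (auto simp: words_def)
next
  show "Inr i \<in> set (t @ map Inl x)" if "t \<in> template k m n'" "i < m" for i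
    using template_var[OF that] by simp
qed

lemma Inl_template: "x \<in> words k n \<Longrightarrow> map Inl x \<in> template k 0 n"
  by (rule templateI) (auto simp: words_def)

lemma append_shift_template:
  assumes "s \<in> template k m n" "t \<in> template k m' n'"
  shows "s @ shift m t \<in> template k (m + m') (n + n')"
proof (rule templateI)
  show "length (s @ shift m t) = n + n'"
    using assms by (simp add: shift_def template_length)
next
  fix u assume "u \<in> set (s @ shift m t)"
  then consider "u \<in> set s" | v where "v \<in> set t" "u = map_sum id ((+) m) v"
    by (auto simp: shift_def)
  then show "(\<exists>a<k. u = Inl a) \<or> (\<exists>i<m + m'. u = Inr i)"
  proof cases
    case 1
    show ?thesis using template_elem[OF assms(1) 1] by auto
  next
    case 2
    show ?thesis using template_elem[OF assms(2) 2(1)] 2(2) by auto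
  qed
next
  fix i assume i: "i < m + m'"
  show "Inr i \<in> set (s @ shift m t)"
  proof (cases "i < m")
    case True
    then show ?thesis using template_var[OF assms(1)] by auto
  next
    case False
    then have "Inr (i - m) \<in> set t" using template_var[OF assms(2)] i by auto
    then have "map_sum id ((+) m) (Inr (i - m)) \<in> set (shift m t)"
      unfolding shift_def set_map by (rule imageI)
    then show ?thesis using False by auto
  qed
qed

lemma inst_append_shift:
  assumes "s \<in> template k m n" "length x = m"
  shows "inst (x @ y) (s @ shift m t) = inst x s @ inst y t"
proof -
  have "inst (x @ y) s = inst x s"
    unfolding inst_def
  proof (rule map_cong[OF refl])
    fix s' assume "s' \<in> set s"
    then show "case_sum (\<lambda>a. a) ((!) (x @ y)) s' = case_sum (\<lambda>a. a) ((!) x) s'"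
      using template_elem[OF assms(1), of s'] assms(2) by (auto simp: nth_append)
  qed
  moreover have "inst (x @ y) (shift m t) = inst y t"
    using assms(2) by (auto simp: inst_def shift_def split: sum.splits)
  ultimately show ?thesis by (simp add: inst_append)
qed

subsection \<open>Replacing a letter\<close>

definition replace :: "nat \<Rightarrow> nat \<Rightarrow> nat list \<Rightarrow> nat list" where
  "replace k i z = map (\<lambda>a. if a = k then i else a) z"

lemma replace_append: "replace k i (x @ y) = replace k i x @ replace k i y"
  by (simp add: replace_def)

lemma length_replace [simp]: "length (replace k i z) = length z"
  by (simp add: replace_def)

lemma replace_replace: "replace k i (replace k i z) = replace k i z"
  by (simp add: replace_def)

lemma replace_words: "z \<in> words (Suc k) n \<Longrightarrow> i < k \<Longrightarrow> replace k i z \<in> words k n"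
  by (fastforce simp: words_def replace_def)

lemma replace_words_Suc: "z \<in> words (Suc k) n \<Longrightarrow> i < k \<Longrightarrow> replace k i z \<in> words (Suc k) n"
  using replace_words words_mono[of k "Suc k" n] by auto

lemma inst_replace:
  assumes "t \<in> template k m n" "length z = m"
  shows "inst (replace k i z) t = replace k i (inst z t)"
proof -
  have "case_sum (\<lambda>a. a) ((!) (replace k i z)) s = (if case_sum (\<lambda>a. a) ((!) z) s = k then i else case_sum (\<lambda>a. a) ((!) z) s)" if "s \<in> set t" for s
    using template_elem[OF assms(1) that] assms(2) by (auto simp: replace_def)
  then show ?thesis
    by (simp add: inst_def replace_def[of k i "map f xs" for f xs])
qed

text \<open>Here \<open>t\<close> may have fixed letters \<open>k\<close>, so \<open>replace\<close>
  and \<open>inst\<close> need not commute; the outer \<open>replace\<close> restores agreement.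
  This makes insensitivity pass to subspaces.\<close>

lemma replace_inst_replace:
  assumes "t \<in> template k' m n" "length z = m"
  shows "replace k i (inst (replace k i z) t) = replace k i (inst z t)"
proof -
  have "(if case_sum (\<lambda>a. a) ((!) (replace k i z)) s = k then i else case_sum (\<lambda>a. a) ((!) (replace k i z)) s) = (if case_sum (\<lambda>a. a) ((!) z) s = k then i else case_sum (\<lambda>a. a) ((!) z) s)" if "s \<in> set t" for s
    using template_elem[OF assms(1) that] assms(2) by (auto simp: replace_def)
  then show ?thesis
    by (simp add: inst_def replace_def[of k i "map f xs" for f xs])
qed

section \<open>The density Hales--Jewett property and colourings\<close>

subsection \<open>The multidimensional density Hales--Jewett property\<close>

text \<open>Densities above 1 are allowed and make the property vacuous, which later guarantees that
  the set of admissible densities is nonempty.\<close>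

definition dhj :: "nat \<Rightarrow> nat \<Rightarrow> real \<Rightarrow> bool" where
  "dhj k m \<delta> \<longleftrightarrow> (\<exists>N. \<forall>n\<ge>N. \<forall>A. \<delta> \<le> avg k n (\<lambda>w. of_bool (A w)) \<longrightarrow>
      (\<exists>t\<in>template k m n. \<forall>z\<in>words k m. A (inst z t)))"

lemma dhjE:
  assumes "dhj k m \<delta>"
  obtains N where "\<And>n A. N \<le> n \<Longrightarrow> \<delta> \<le> avg k n (\<lambda>w. of_bool (A w)) \<Longrightarrow>
      \<exists>t\<in>template k m n. \<forall>z\<in>words k m. A (inst z t)"
  using assms unfolding dhj_def by blast

text \<open>By Markov many \<open>y\<close> have a dense fibre, each dense fibre contains a
  subspace, and pigeonhole over the finitely many templates makes one subspace common to many
  \<open>y\<close>. The two alphabets are separate because \<open>dhj_improve\<close> seeks lines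
  over \<open>k\<close> letters in fibres indexed by words over \<open>Suc k\<close>.\<close>

lemma dhj_common_template:
  assumes "k > 0" "K > 0" "\<delta> > 0"
    and N: "\<And>A. \<delta> / 2 \<le> avg k N (\<lambda>w. of_bool (A w)) \<Longrightarrow>
      \<exists>t\<in>template k m N. \<forall>z\<in>words k m. A (inst z t)"
    and "\<delta> \<le> avg K n (\<lambda>y. avg k N (\<lambda>w. of_bool (Q w y)))"
  obtains t where "t \<in> template k m N"
    "\<delta> / 2 / real (card (template k m N)) \<le> avg K n (\<lambda>y. of_bool (\<forall>z\<in>words k m. Q (inst z t) y))"
proof -
  have "\<delta> / 2 \<le> avg K n (\<lambda>y. of_bool (\<delta> / 2 \<le> avg k N (\<lambda>w. of_bool (Q w y))))"
  proof -
    have "avg k N (\<lambda>w. of_bool (Q w y)) \<le> 1" for y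
      using assms(1) by (intro avg_le_const) auto
    then show ?thesis
      using avg_markov[of K n "\<lambda>y. avg k N (\<lambda>w. of_bool (Q w y))" "\<delta> / 2"] assms(2,3,5)
      by auto
  qed
  also have "\<dots> \<le> avg K n (\<lambda>y. of_bool (\<exists>t\<in>template k m N. \<forall>z\<in>words k m. Q (inst z t) y))"
    using N by (intro avg_mono) auto
  finally show ?thesis
    by (rule avg_pigeonhole[OF assms(2) finite_template[of k m N] half_gt_zero[OF assms(3)]])
       (rule that)
qed

text \<open>One dimension at a time: a line in the last \<open>N1\<close> coordinates is common to
  many prefixes, and these prefixes form a dense set to which the induction hypothesis
  applies.\<close>

lemma dhj_multidim:
  assumes k: "k > 0" and line: "\<And>\<delta>. \<delta> > 0 \<Longrightarrow> dhj k 1 \<delta>" and "\<delta> > 0"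
  shows "dhj k m \<delta>"
  using \<open>\<delta> > 0\<close>
proof (induction m arbitrary: \<delta>)
  case 0
  have "\<exists>t\<in>template k 0 n. \<forall>z\<in>words k 0. A (inst z t)"
    if A: "\<delta> \<le> avg k n (\<lambda>w. of_bool (A w))" for n A
  proof -
    obtain w where w: "w \<in> words k n" "\<delta> \<le> of_bool (A w)"
      using avg_exists_ge[OF k A] by blast
    then have "A w" using \<open>\<delta> > 0\<close> by (auto simp: of_bool_def split: if_splits)
    then show ?thesis
      using Inl_template[OF w(1)] by (intro bexI[of _ "map Inl w"]) auto
  qed
  then show ?case unfolding dhj_def by blast
next
  case (Suc m)
  obtain N1 where N1: "\<And>n A. N1 \<le> n \<Longrightarrow> \<delta> / 2 \<le> avg k n (\<lambda>w. of_bool (A w)) \<Longrightarrow>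
      \<exists>t\<in>template k 1 n. \<forall>z\<in>words k 1. A (inst z t)"
    using dhjE[OF line[of "\<delta> / 2"]] Suc.prems by auto
  \<comment> \<open>The \<open>+ 1\<close> keeps \<open>\<theta>\<close> positive before any
    template is known to exist.\<close>
  define \<theta> where "\<theta> = \<delta> / 2 / real (card (template k 1 N1) + 1)"
  have "\<theta> > 0" using Suc.prems by (simp add: \<theta>_def)
  then obtain N2 where N2: "\<And>n A. N2 \<le> n \<Longrightarrow> \<theta> \<le> avg k n (\<lambda>w. of_bool (A w)) \<Longrightarrow>
      \<exists>t\<in>template k m n. \<forall>z\<in>words k m. A (inst z t)"
    using dhjE[OF Suc.IH[of \<theta>]] by auto
  have "\<exists>t\<in>template k (Suc m) n. \<forall>z\<in>words k (Suc m). A (inst z t)"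
    if n: "N1 + N2 \<le> n" and A: "\<delta> \<le> avg k n (\<lambda>w. of_bool (A w))" for n A
  proof -
    define n' where "n' = n - N1"
    have n': "n = n' + N1" "N2 \<le> n'" using n by (auto simp: n'_def)
    have "\<delta> \<le> avg k n' (\<lambda>x. avg k N1 (\<lambda>y. of_bool (A (x @ y))))"
      using A by (simp add: n' avg_append)
    then obtain t where t: "t \<in> template k 1 N1"
      "\<delta> / 2 / real (card (template k 1 N1)) \<le> avg k n' (\<lambda>x. of_bool (\<forall>z\<in>words k 1. A (x @ inst z t)))"
      using dhj_common_template[OF k k Suc.prems, of N1 1 n' "\<lambda>y x. A (x @ y)"] N1 by blast
    have "card (template k 1 N1) > 0"
      using t(1) finite_template by (auto simp: card_gt_0_iff)
    then have "\<theta> \<le> \<delta> / 2 / real (card (template k 1 N1))"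
      unfolding \<theta>_def using Suc.prems by (intro divide_left_mono) auto
    then obtain s where s: "s \<in> template k m n'"
      "\<And>x z. x \<in> words k m \<Longrightarrow> z \<in> words k 1 \<Longrightarrow> A (inst x s @ inst z t)"
      using N2[OF n'(2), of "\<lambda>x. \<forall>z\<in>words k 1. A (x @ inst z t)"] t(2) by force
    show ?thesis
    proof (intro bexI ballI)
      show "s @ shift m t \<in> template k (Suc m) n"
        using append_shift_template[OF s(1) t(1)] by (simp add: n')
      fix z assume "z \<in> words k (Suc m)"
      then obtain x y where xy: "z = x @ y" "x \<in> words k m" "y \<in> words k 1"
        using words_append_cases[of z k m 1] by auto
      then show "A (inst z (s @ shift m t))"
        using s(2) inst_append_shift[OF s(1) words_length] by auto
    qed
  qed
  then show ?case unfolding dhj_def by blast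
qed

subsection \<open>Colourings\<close>

text \<open>Colours are natural numbers throughout, so that the induction hypotheses below apply to
  vectors of colours as well; this lemma encodes a vector indexed by \<open>S\<close> as a single colour.\<close>

lemma vector_colouring:
  assumes "finite S"
  shows "\<exists>R. \<forall>f :: 'a \<Rightarrow> 's \<Rightarrow> nat. (\<forall>x s. f x s < r) \<longrightarrow>
      (\<exists>g :: _ \<Rightarrow> nat. (\<forall>x. g x < R) \<and> (\<forall>x y. g x = g y \<longleftrightarrow> (\<forall>s\<in>S. f x s = f y s)))"
proof -
  define V where "V = (PiE S (\<lambda>_. {..<r}) :: ('s \<Rightarrow> nat) set)"
  have "finite V" unfolding V_def using assms by (intro finite_PiE) auto
  then obtain h :: "('s \<Rightarrow> nat) \<Rightarrow> nat" where h: "bij_betw h V {0..<card V}"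
    using ex_bij_betw_finite_nat by blast
  have "\<exists>g :: _ \<Rightarrow> nat. (\<forall>x. g x < card V) \<and> (\<forall>x y. g x = g y \<longleftrightarrow> (\<forall>s\<in>S. f x s = f y s))"
    if f: "\<forall>x s. f x s < r" for f :: "'a \<Rightarrow> 's \<Rightarrow> nat"
  proof (intro exI conjI allI)
    have V: "restrict (f x) S \<in> V" for x
      using f by (auto simp: V_def)
    show "h (restrict (f x) S) < card V" for x
      using bij_betwE[OF h] V[of x] by fastforce
    fix x y
    have "h (restrict (f x) S) = h (restrict (f y) S) \<longleftrightarrow> restrict (f x) S = restrict (f y) S"
      using inj_on_eq_iff[OF bij_betw_imp_inj_on[OF h] V V] .
    also have "\<dots> \<longleftrightarrow> (\<forall>s\<in>S. f x s = f y s)"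
      by (metis restrict_apply' restrict_ext)
    finally show "h (restrict (f x) S) = h (restrict (f y) S) \<longleftrightarrow> (\<forall>s\<in>S. f x s = f y s)" .
  qed
  then show ?thesis by (intro exI[of _ "card V"] allI impI)
qed

text \<open>Shelah's lemma: on a suitable subspace the colouring does not distinguish the last two
  letters. A block is long enough that two of the words \<open>j\<dots>j(j+1)\<dots>(j+1)\<close> look alike.\<close>

lemma shelah_line:
  fixes c :: "nat list \<Rightarrow> nat list \<Rightarrow> nat" and g :: "nat list \<Rightarrow> nat"
  assumes g: "\<forall>w. g w < n" "\<forall>w w'. g w = g w' \<longrightarrow> (\<forall>x\<in>X. c w x = c w' x)"
  obtains t where "t \<in> template (j + 2) 1 n" "\<And>x. x \<in> X \<Longrightarrow> c (inst [j] t) x = c (inst [Suc j] t) x"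
proof -
  define w where "w i = replicate i j @ replicate (n - i) (Suc j)" for i
  have "\<not> inj_on (\<lambda>i. g (w i)) {..n}"
  proof
    assume "inj_on (\<lambda>i. g (w i)) {..n}"
    moreover have "(\<lambda>i. g (w i)) ` {..n} \<subseteq> {..<n}" using g(1) by auto
    ultimately have "card {..n} \<le> card {..<n}" by (rule card_inj_on_le) auto
    then show False by simp
  qed
  then obtain a' b' where ab': "a' \<le> n" "b' \<le> n" "g (w a') = g (w b')" "a' \<noteq> b'"
    by (auto simp: inj_on_def)
  define a b where "a = min a' b'" and "b = max a' b'"
  have ab: "a < b" "b \<le> n" "g (w a) = g (w b)"
    using ab' by (auto simp: a_def b_def min_def max_def)
  \<comment> \<open>The words \<open>w a\<close> and \<open>w b\<close> differ exactly at the
    positions from \<open>a\<close> up to \<open>b\<close>, which become the variable: its value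
    \<open>j\<close> gives \<open>w b\<close> and \<open>Suc j\<close> gives
    \<open>w a\<close>.\<close>
  define t :: "(nat + nat) list" where
    "t = replicate a (Inl j) @ replicate (b - a) (Inr 0) @ replicate (n - b) (Inl (Suc j))"
  show ?thesis
  proof
    show "t \<in> template (j + 2) 1 n"
    proof (rule templateI)
      show "length t = n" using ab by (simp add: t_def)
    qed (use ab in \<open>auto simp: t_def\<close>)
    have "replicate b j = replicate a j @ replicate (b - a) j"
      using ab replicate_add[of a "b - a" j] by simp
    then have "inst [j] t = w b"
      by (simp add: inst_def t_def w_def)
    moreover have "replicate (n - a) (Suc j) = replicate (b - a) (Suc j) @ replicate (n - b) (Suc j)"
      using ab replicate_add[of "b - a" "n - b" "Suc j"] by simp
    then have "inst [Suc j] t = w a"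
      by (simp add: inst_def t_def w_def)
    ultimately show "c (inst [j] t) x = c (inst [Suc j] t) x" if "x \<in> X" for x
      using g(2)[rule_format, OF ab(3) that] by simp
  qed
qed

text \<open>A line in the last block is found first, against all prefixes at once; the prefixes are
  then coloured by the vector of colours over the letters put on that line, and the induction
  hypothesis is applied to them. Lengths are fixed in the opposite order, since the last block
  depends on \<open>n1\<close>.\<close>

lemma shelah_subspace:
  "\<exists>n. \<forall>c :: nat list \<Rightarrow> nat. (\<forall>w. c w < r) \<longrightarrow>
     (\<exists>t\<in>template (j + 2) m n. \<forall>z\<in>words (j + 2) m. c (inst z t) = c (inst (replace (Suc j) j z) t))"
proof (induction m arbitrary: r)
  case 0
  show ?case by (intro exI[of _ 0]) (auto simp: replace_def template_def)
next
  case (Suc m)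
  obtain R1 where R1: "\<forall>f :: nat list \<Rightarrow> nat \<Rightarrow> nat. (\<forall>x s. f x s < r) \<longrightarrow>
      (\<exists>g :: _ \<Rightarrow> nat. (\<forall>x. g x < R1) \<and> (\<forall>x y. g x = g y \<longleftrightarrow> (\<forall>s\<in>{..<j + 2}. f x s = f y s)))"
    by (rule exE[OF vector_colouring[OF finite_lessThan]])
  obtain n1 where n1: "\<And>c. (\<forall>w. c w < R1) \<Longrightarrow>
     (\<exists>t\<in>template (j + 2) m n1. \<forall>z\<in>words (j + 2) m. c (inst z t) = c (inst (replace (Suc j) j z) t))"
    using Suc.IH[of R1] by blast
  \<comment> \<open>\<open>n2\<close> is both the number of colours of the vector colouring and the
    length of the last block, as \<open>shelah_line\<close> demands.\<close>
  obtain n2 where n2: "\<forall>f :: nat list \<Rightarrow> nat list \<Rightarrow> nat. (\<forall>x s. f x s < r) \<longrightarrow>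
      (\<exists>g :: _ \<Rightarrow> nat. (\<forall>x. g x < n2) \<and>
        (\<forall>x y. g x = g y \<longleftrightarrow> (\<forall>s\<in>words (j + 2) n1. f x s = f y s)))"
    by (rule exE[OF vector_colouring[OF finite_words]])
  have "\<exists>t\<in>template (j + 2) (Suc m) (n1 + n2). \<forall>z\<in>words (j + 2) (Suc m).
          c (inst z t) = c (inst (replace (Suc j) j z) t)"
    if c: "\<forall>w. c w < r" for c :: "nat list \<Rightarrow> nat"
  proof -
    obtain g where g: "\<forall>w. g w < n2"
      "\<forall>w w'. g w = g w' \<longrightarrow> (\<forall>x\<in>words (j + 2) n1. c (x @ w) = c (x @ w'))"
      using n2[rule_format, of "\<lambda>w x. c (x @ w)"] c by auto
    obtain l where l: "l \<in> template (j + 2) 1 n2"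
      "\<And>x. x \<in> words (j + 2) n1 \<Longrightarrow> c (x @ inst [j] l) = c (x @ inst [Suc j] l)"
      using g by (rule shelah_line[of g n2 "words (j + 2) n1" "\<lambda>w x. c (x @ w)" j]) auto
    obtain h where h: "\<forall>x. h x < R1"
      "\<forall>x y. h x = h y \<longrightarrow> (\<forall>a\<in>{..<j + 2}. c (x @ inst [a] l) = c (y @ inst [a] l))"
      using R1[rule_format, of "\<lambda>x a. c (x @ inst [a] l)"] c by auto
    obtain t where t: "t \<in> template (j + 2) m n1"
      "\<And>z. z \<in> words (j + 2) m \<Longrightarrow> h (inst z t) = h (inst (replace (Suc j) j z) t)"
      using n1[OF h(1)] by blast
    show ?thesis
    proof (intro bexI ballI)
      show "t @ shift m l \<in> template (j + 2) (Suc m) (n1 + n2)"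
        using append_shift_template[OF t(1) l(1)] by simp
      fix z assume "z \<in> words (j + 2) (Suc m)"
      then obtain x y where z: "z = x @ y" and x: "x \<in> words (j + 2) m" and y: "y \<in> words (j + 2) 1"
        using words_append_cases[of z "j + 2" m 1] by auto
      obtain a where a: "a < j + 2" "y = [a]" using y singleton_words by blast
      have x': "replace (Suc j) j x \<in> words (j + 2) m"
        using replace_words_Suc[of x "Suc j" m j] x by simp
      have "c (inst x t @ inst [a] l) = c (inst (replace (Suc j) j x) t @ inst [a] l)"
        using h(2)[rule_format, OF t(2)[OF x], of a] a by simp
      also have "\<dots> = c (inst (replace (Suc j) j x) t @ inst (replace (Suc j) j [a]) l)"
        using l(2)[OF inst_words[OF t(1) x']] by (simp add: replace_def)
      finally show "c (inst z (t @ shift m l)) = c (inst (replace (Suc j) j z) (t @ shift m l))"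
        using inst_append_shift[OF t(1)] words_length[OF x] by (simp add: z a replace_append)
    qed
  qed
  then show ?case by blast
qed

text \<open>Induction on the alphabet: on a Shelah subspace the last letter can be traded for the
  one before it, so a line that is monochromatic without the last letter stays so with it.\<close>

lemma hales_jewett_line:
  assumes "k > 0"
  shows "\<exists>n. \<forall>c :: nat list \<Rightarrow> nat. (\<forall>w. c w < r) \<longrightarrow>
     (\<exists>t\<in>template k 1 n. \<forall>a<k. c (inst [a] t) = c (inst [0] t))"
proof -
  obtain k' where k': "k = Suc k'" using assms by (cases k) auto
  show ?thesis unfolding k'
  proof (induction k')
    case 0
    show ?case
      by (intro exI[of _ 1] allI impI bexI[of _ "[Inr 0]"]) (auto simp: template_def)
  next
    case (Suc j)
    obtain m where m: "\<And>c. (\<forall>w. c w < r) \<Longrightarrow>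
        \<exists>t\<in>template (Suc j) 1 m. \<forall>a<Suc j. c (inst [a] t) = c (inst [0] t)"
      using Suc.IH by blast
    obtain n where n: "\<And>c :: nat list \<Rightarrow> nat. (\<forall>w. c w < r) \<Longrightarrow>
        \<exists>t\<in>template (j + 2) m n. \<forall>z\<in>words (j + 2) m. c (inst z t) = c (inst (replace (Suc j) j z) t)"
      using shelah_subspace[of r j m] by blast
    have "\<exists>t\<in>template (Suc (Suc j)) 1 n. \<forall>a<Suc (Suc j). c (inst [a] t) = c (inst [0] t)"
      if c: "\<forall>w. c w < r" for c :: "nat list \<Rightarrow> nat"
    proof -
      obtain t where t: "t \<in> template (j + 2) m n"
        "\<And>z. z \<in> words (j + 2) m \<Longrightarrow> c (inst z t) = c (inst (replace (Suc j) j z) t)"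
        using n[OF c] by blast
      obtain l where l: "l \<in> template (Suc j) 1 m"
        "\<And>a. a < Suc j \<Longrightarrow> c (inst (inst [a] l) t) = c (inst (inst [0] l) t)"
        using m[of "\<lambda>x. c (inst x t)"] c by blast
      have l': "l \<in> template (j + 2) 1 m"
        using l(1) template_mono[of "Suc j" "j + 2"] by auto
      have last: "c (inst (inst [Suc j] l) t) = c (inst (inst [j] l) t)"
      proof -
        have "inst [Suc j] l \<in> words (j + 2) m"
          by (rule inst_words[OF l']) (simp add: words_def)
        then have "c (inst (inst [Suc j] l) t) = c (inst (replace (Suc j) j (inst [Suc j] l)) t)"
          by (rule t(2))
        also have "replace (Suc j) j (inst [Suc j] l) = inst [j] l"
          using inst_replace[OF l(1), of "[Suc j]" j] by (simp add: replace_def)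
        finally show ?thesis .
      qed
      show ?thesis
      proof (intro bexI allI impI)
        show "compose l t \<in> template (Suc (Suc j)) 1 n" using compose_template[OF l' t(1)] by simp
        fix a assume "a < Suc (Suc j)"
        then consider "a < Suc j" | "a = Suc j" by linarith
        then have "c (inst (inst [a] l) t) = c (inst (inst [0] l) t)"
          using l(2)[of a] l(2)[of j] last by cases simp_all
        then show "c (inst [a] (compose l t)) = c (inst [0] (compose l t))"
          using inst_compose[OF t(1) template_length[OF l']] by simp
      qed
    qed
    then show ?case by blast
  qed
qed

definition first_index :: "nat \<Rightarrow> nat list \<Rightarrow> nat" where
  "first_index k z = length (takeWhile (\<lambda>a. a \<noteq> k) z)"

lemma first_index_Cons: "first_index k (a # x) = (if a = k then 0 else Suc (first_index k x))"
  by (simp add: first_index_def)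

lemma first_index_less: "k \<in> set x \<Longrightarrow> first_index k x < length x"
  unfolding first_index_def by (induction x) auto

lemma nth_first_index: "k \<in> set x \<Longrightarrow> x ! first_index k x = k"
  unfolding first_index_def by (induction x) auto

definition lower :: "nat \<Rightarrow> nat \<Rightarrow> (nat + nat) list \<Rightarrow> (nat + nat) list" where
  "lower k a t = map (\<lambda>s. if s = Inl k then Inl a else s) t"

lemma lower_same [simp]: "lower k k t = t"
  by (simp add: lower_def map_idI)

lemma words_Suc_not_in: "z \<in> words (Suc k) n \<Longrightarrow> k \<notin> set z \<Longrightarrow> z \<in> words k n"
  unfolding words_def by (auto simp: less_Suc_eq)

text \<open>Colouring the last block by the vector of colours over all prefixes yields a line on
  which the last letter has no influence; it may then be set to 0 and the prefix treated by
  induction.\<close>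

lemma hales_jewett_multidim:
  "\<exists>n. \<forall>c :: nat list \<Rightarrow> nat. (\<forall>w. c w < r) \<longrightarrow>
     (\<exists>t\<in>template (Suc k) m n.
        (\<forall>z\<in>words (Suc k) m. \<forall>z'\<in>words (Suc k) m. c (inst z t) = c (inst z' t)))"
proof (induction m)
  case 0
  show ?case by (intro exI[of _ 0]) (auto simp: template_def)
next
  case (Suc m)
  obtain n1 where n1: "\<forall>c :: nat list \<Rightarrow> nat. (\<forall>w. c w < r) \<longrightarrow>
     (\<exists>t\<in>template (Suc k) m n1.
        (\<forall>z\<in>words (Suc k) m. \<forall>z'\<in>words (Suc k) m. c (inst z t) = c (inst z' t)))"
    using Suc.IH by (rule exE)
  obtain R where R: "\<forall>f :: nat list \<Rightarrow> nat list \<Rightarrow> nat. (\<forall>x s. f x s < r) \<longrightarrow>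
      (\<exists>g :: _ \<Rightarrow> nat. (\<forall>x. g x < R) \<and>
        (\<forall>x y. g x = g y \<longleftrightarrow> (\<forall>s\<in>words (Suc k) n1. f x s = f y s)))"
    by (rule exE[OF vector_colouring[OF finite_words]])
  obtain n2 where n2: "\<forall>c :: nat list \<Rightarrow> nat. (\<forall>w. c w < R) \<longrightarrow>
     (\<exists>t\<in>template (Suc k) 1 n2. \<forall>a<Suc k. c (inst [a] t) = c (inst [0] t))"
    by (rule exE[OF hales_jewett_line[OF zero_less_Suc]])
  have "\<exists>t\<in>template (Suc k) (Suc m) (n1 + n2).
      (\<forall>z\<in>words (Suc k) (Suc m). \<forall>z'\<in>words (Suc k) (Suc m). c (inst z t) = c (inst z' t))"
    if c: "\<forall>w. c w < r" for c :: "nat list \<Rightarrow> nat"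
  proof -
    obtain g where g: "\<forall>w. g w < R"
      "\<forall>w w'. g w = g w' \<longrightarrow> (\<forall>x\<in>words (Suc k) n1. c (x @ w) = c (x @ w'))"
      using R[rule_format, of "\<lambda>w x. c (x @ w)"] c by auto
    obtain l where l: "l \<in> template (Suc k) 1 n2" "\<And>a. a < Suc k \<Longrightarrow> g (inst [a] l) = g (inst [0] l)"
      using n2 g(1) by metis
    have l': "c (x @ inst [a] l) = c (x @ inst [0] l)" if "a < Suc k" "x \<in> words (Suc k) n1" for a x
      using g(2)[rule_format, OF l(2)[OF that(1)] that(2)] .
    obtain t where t: "t \<in> template (Suc k) m n1"
      "\<And>z z'. z \<in> words (Suc k) m \<Longrightarrow> z' \<in> words (Suc k) m \<Longrightarrow>
        c (inst z t @ inst [0] l) = c (inst z' t @ inst [0] l)"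
      using n1[rule_format, of "\<lambda>x. c (x @ inst [0] l)"] c by blast
    have "\<exists>x\<in>words (Suc k) m. c (inst z (t @ shift m l)) = c (inst x t @ inst [0] l)"
      if zw: "z \<in> words (Suc k) (Suc m)" for z
    proof -
      obtain x y where z: "z = x @ y" and x: "x \<in> words (Suc k) m" and y: "y \<in> words (Suc k) 1"
        using words_append_cases[of z "Suc k" m 1] zw by auto
      obtain a where a: "a < Suc k" "y = [a]" using y singleton_words by blast
      have "c (inst z (t @ shift m l)) = c (inst x t @ inst [a] l)"
        using inst_append_shift[OF t(1) words_length[OF x]] by (simp add: z a)
      then show ?thesis using l'[OF a(1) inst_words[OF t(1) x]] x by auto
    qed
    then have "\<forall>z\<in>words (Suc k) (Suc m). \<forall>z'\<in>words (Suc k) (Suc m).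
        c (inst z (t @ shift m l)) = c (inst z' (t @ shift m l))"
      using t(2) by metis
    moreover have "t @ shift m l \<in> template (Suc k) (Suc m) (n1 + n2)"
      using append_shift_template[OF t(1) l(1)] by simp
    ultimately show ?thesis
      by blast
  qed
  then show ?case by blast
qed

subsection \<open>The Graham--Rothschild theorem for lines\<close>

text \<open>A word over \<open>{0..k}\<close> containing the letter \<open>k\<close> is a variable word over \<open>{0..<k}\<close>, with \<open>k\<close>
  as the variable. In \<open>bind k t\<close> the fixed letters \<open>k\<close> of \<open>t\<close> are tied to a new variable in front.\<close>

definition bind :: "nat \<Rightarrow> (nat + nat) list \<Rightarrow> (nat + nat) list" where
  "bind k t = map (\<lambda>s. case s of Inl a \<Rightarrow> if a = k then Inr 0 else Inl a | Inr i \<Rightarrow> Inr (Suc i)) t"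

lemma length_bind [simp]: "length (bind k t) = length t"
  by (simp add: bind_def)

lemma inst_bind: "inst (a # z) (bind k t) = inst z (lower k a t)"
  by (auto simp: inst_def bind_def lower_def split: sum.splits)

lemma bind_template:
  assumes f: "f \<in> template (Suc k) m n"
  shows "Inr 0 # bind k f \<in> template k (Suc m) (Suc n)"
proof (rule templateI)
  show "length (Inr 0 # bind k f) = Suc n"
    using f by (simp add: template_length)
next
  fix u assume "u \<in> set (Inr 0 # bind k f)"
  then consider "u = Inr 0" | s where "s \<in> set f"
      "u = (case s of Inl a \<Rightarrow> if a = k then Inr 0 else Inl a | Inr i \<Rightarrow> Inr (Suc i))"
    by (auto simp: bind_def)
  then show "(\<exists>a<k. u = Inl a) \<or> (\<exists>i<Suc m. u = Inr i)"
  proof cases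
    case 2
    show ?thesis using template_elem[OF f 2(1)] 2(2) by (auto simp: less_Suc_eq)
  qed simp
next
  fix i assume i: "i < Suc m"
  show "Inr i \<in> set (Inr 0 # bind k f)"
  proof (cases i)
    case (Suc i')
    then have "Inr i' \<in> set f" using template_var[OF f] i by simp
    then have "(case Inr i' of Inl a \<Rightarrow> if a = k then Inr 0 else Inl a | Inr i \<Rightarrow> Inr (Suc i))
        \<in> set (bind k f)"
      unfolding bind_def set_map by (rule imageI)
    then show ?thesis using Suc by simp
  qed simp
qed

lemma variable_template: "[Inr 0] \<in> template k 1 1"
  by (auto simp: template_def)

lemma Cons_shift_template: "t \<in> template k m n \<Longrightarrow> Inr 0 # shift 1 t \<in> template k (Suc m) (Suc n)"
  using append_shift_template[OF variable_template] by fastforce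

lemma inst_Cons_shift: "inst (a # z) (Inr 0 # shift 1 t) = a # inst z t"
  using inst_append_shift[OF variable_template, of "[a]" z t] by (simp add: inst_def[of "[a]"])

text \<open>Test words realising each possible position of the first \<open>k\<close>; they turn a
  colouring that depends only on this position into a function of the position.\<close>

lemma first_index_probe:
  assumes "j < m" "k > 0"
  shows "first_index k (replicate j 0 @ replicate (m - j) k) = j"
    and "replicate j 0 @ replicate (m - j) k \<in> words (Suc k) m"
    and "k \<in> set (replicate j 0 @ replicate (m - j) k)"
proof -
  have "takeWhile (\<lambda>a. a \<noteq> k) (replicate j 0 @ replicate (m - j) k)
      = replicate j 0 @ takeWhile (\<lambda>a. a \<noteq> k) (replicate (m - j) k)"
    using assms by (intro takeWhile_append2) simp
  then show "first_index k (replicate j 0 @ replicate (m - j) k) = j"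
    by (simp add: first_index_def)
qed (use assms in \<open>auto simp: words_def\<close>)

text \<open>First of three reductions for colourings of variable words: the colour sees only the
  part before the first variable, then only the length of this part, and finally it is constant.
  Words without \<open>k\<close> are exempt because they describe points, not lines.\<close>

definition prefix_coloured :: "nat \<Rightarrow> nat \<Rightarrow> (nat list \<Rightarrow> nat) \<Rightarrow> bool" where
  "prefix_coloured k n c \<longleftrightarrow> (\<forall>z\<in>words (Suc k) n. \<forall>z'\<in>words (Suc k) n.
     k \<in> set z \<longrightarrow> k \<in> set z' \<longrightarrow>
     takeWhile (\<lambda>a. a \<noteq> k) z = takeWhile (\<lambda>a. a \<noteq> k) z' \<longrightarrow> c z = c z')"

text \<open>Split on the first letter. If it is \<open>k\<close>, the rest must have no influence,
  which is arranged by a monochromatic subspace over \<open>Suc k\<close> letters. If it is smaller,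
  the rest is handled by induction, for the vector of colours over all smaller first
  letters.\<close>

lemma prefix_coloured_subspace:
  "\<exists>n. \<forall>c :: nat list \<Rightarrow> nat. (\<forall>w. c w < r) \<longrightarrow>
     (\<exists>e\<in>template k m n. prefix_coloured k m (\<lambda>z. c (inst z e)))"
proof (induction m arbitrary: r)
  case 0
  show ?case by (intro exI[of _ 0]) (auto simp: template_def prefix_coloured_def)
next
  case (Suc m)
  obtain R where R: "\<forall>f :: nat list \<Rightarrow> nat \<Rightarrow> nat. (\<forall>x s. f x s < r) \<longrightarrow>
      (\<exists>g :: _ \<Rightarrow> nat. (\<forall>x. g x < R) \<and> (\<forall>x y. g x = g y \<longleftrightarrow> (\<forall>s\<in>{..<k}. f x s = f y s)))"
    by (rule exE[OF vector_colouring[OF finite_lessThan]])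
  obtain m' where m': "\<forall>c :: nat list \<Rightarrow> nat. (\<forall>w. c w < R) \<longrightarrow>
     (\<exists>e\<in>template k m m'. prefix_coloured k m (\<lambda>z. c (inst z e)))"
    by (rule exE[OF Suc.IH[of R]])
  obtain M where M: "\<forall>c :: nat list \<Rightarrow> nat. (\<forall>w. c w < r) \<longrightarrow>
     (\<exists>t\<in>template (Suc k) m' M.
        (\<forall>z\<in>words (Suc k) m'. \<forall>z'\<in>words (Suc k) m'. c (inst z t) = c (inst z' t)))"
    by (rule exE[OF hales_jewett_multidim])
  have "\<exists>e\<in>template k (Suc m) (Suc M). prefix_coloured k (Suc m) (\<lambda>z. c (inst z e))"
    if c: "\<forall>w. c w < r" for c :: "nat list \<Rightarrow> nat"
  proof -
    obtain f where f: "f \<in> template (Suc k) m' M"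
      "\<And>z z'. z \<in> words (Suc k) m' \<Longrightarrow> z' \<in> words (Suc k) m' \<Longrightarrow> c (k # inst z f) = c (k # inst z' f)"
      using M[rule_format, of "\<lambda>z. c (k # z)"] c by blast
    \<comment> \<open>\<open>f\<close> may have fixed letters \<open>k\<close>, which a template
      over \<open>k\<close> letters cannot. Tying them to the first variable restores
      \<open>f\<close> whenever that variable takes the value \<open>k\<close>.\<close>
    define e0 where "e0 = Inr 0 # bind k f"
    have e0: "e0 \<in> template k (Suc m') (Suc M)" unfolding e0_def by (rule bind_template[OF f(1)])
    have inst_e0: "inst (a # z) e0 = a # inst z (lower k a f)" for a z
      using inst_bind[of a z k f] by (simp add: e0_def inst_def)
    obtain g where g: "\<forall>x. g x < R"
      "\<forall>x y. g x = g y \<longleftrightarrow> (\<forall>a\<in>{..<k}. c (inst (a # x) e0) = c (inst (a # y) e0))"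
      using R[rule_format, of "\<lambda>x a. c (inst (a # x) e0)"] c by auto
    obtain e1 where e1: "e1 \<in> template k m m'" "prefix_coloured k m (\<lambda>z. g (inst z e1))"
      using m' g(1) by blast
    have e1': "Inr 0 # shift 1 e1 \<in> template k (Suc m) (Suc m')" by (rule Cons_shift_template[OF e1(1)])
    define e where "e = compose (Inr 0 # shift 1 e1) e0"
    have e: "e \<in> template k (Suc m) (Suc M)" unfolding e_def by (rule compose_template[OF e1' e0])
    have inst_e: "inst (a # z) e = inst (a # inst z e1) e0" for a z
      unfolding e_def inst_compose[OF e0 template_length[OF e1']] inst_Cons_shift ..
    have "c (inst z e) = c (inst z' e)"
      if z: "z \<in> words (Suc k) (Suc m)" "z' \<in> words (Suc k) (Suc m)" and k: "k \<in> set z" "k \<in> set z'"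
        and eq: "takeWhile (\<lambda>a. a \<noteq> k) z = takeWhile (\<lambda>a. a \<noteq> k) z'" for z z'
    proof -
      obtain a x where x: "z = a # x" "a < Suc k" "x \<in> words (Suc k) m"
        using words_Suc_cases[OF z(1)] .
      obtain a' x' where x': "z' = a' # x'" "a' < Suc k" "x' \<in> words (Suc k) m"
        using words_Suc_cases[OF z(2)] .
      have [simp]: "a' = a" using eq by (simp add: x(1) x'(1) split: if_splits)
      show ?thesis
      proof (cases "a = k")
        case True
        then show ?thesis
          using f(2)[OF inst_words_le[OF e1(1) _ x(3)] inst_words_le[OF e1(1) _ x'(3)]]
          unfolding x(1) x'(1) inst_e inst_e0 by simp
      next
        case False
        then have "k \<in> set x" "k \<in> set x'" "takeWhile (\<lambda>a. a \<noteq> k) x = takeWhile (\<lambda>a. a \<noteq> k) x'"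
          using k eq by (simp_all add: x(1) x'(1))
        then have "g (inst x e1) = g (inst x' e1)"
          using e1(2) x(3) x'(3) unfolding prefix_coloured_def by blast
        then have "c (inst (a # inst x e1) e0) = c (inst (a # inst x' e1) e0)"
          using g(2) False x(2) by (metis lessThan_iff less_antisym)
        then show ?thesis
          unfolding x(1) x'(1) inst_e by simp
      qed
    qed
    then show ?thesis using e unfolding prefix_coloured_def by blast
  qed
  then show ?case by blast
qed

text \<open>Put a line block in front. If its letter is \<open>k\<close>, the first \<open>k\<close>
  lies inside the block and \<open>prefix_coloured\<close> makes the rest irrelevant. If its letter
  is below \<open>k\<close>, a Hales--Jewett line makes the choice of this letter irrelevant, and
  the rest is handled by induction.\<close>

lemma first_index_subspace:
  assumes k: "k > 0"
  shows "\<exists>n. \<forall>c :: nat list \<Rightarrow> nat. (\<forall>w. c w < r) \<longrightarrow> prefix_coloured k n c \<longrightarrow>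
     (\<exists>e\<in>template k m n. \<forall>z\<in>words (Suc k) m. \<forall>z'\<in>words (Suc k) m.
        k \<in> set z \<longrightarrow> k \<in> set z' \<longrightarrow> first_index k z = first_index k z' \<longrightarrow> c (inst z e) = c (inst z' e))"
proof (induction m arbitrary: r)
  case 0
  show ?case by (intro exI[of _ 0]) (auto simp: template_def)
next
  case (Suc m)
  \<comment> \<open>Once the rest depends only on its first index, \<open>m\<close> test words
    suffice. So \<open>R1\<close> and \<open>n1\<close> can be fixed before \<open>n2\<close>, which
    depends on them.\<close>
  obtain R1 where R1: "\<forall>f :: nat list \<Rightarrow> nat \<Rightarrow> nat. (\<forall>x s. f x s < r) \<longrightarrow>
      (\<exists>g :: _ \<Rightarrow> nat. (\<forall>x. g x < R1) \<and> (\<forall>x y. g x = g y \<longleftrightarrow> (\<forall>s\<in>{..<m}. f x s = f y s)))"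
    by (rule exE[OF vector_colouring[OF finite_lessThan]])
  obtain n1 where n1: "\<forall>c :: nat list \<Rightarrow> nat. (\<forall>w. c w < R1) \<longrightarrow>
     (\<exists>t\<in>template k 1 n1. \<forall>a<k. c (inst [a] t) = c (inst [0] t))"
    by (rule exE[OF hales_jewett_line[OF k]])
  obtain R2 where R2: "\<forall>f :: nat list \<Rightarrow> nat list \<Rightarrow> nat. (\<forall>x s. f x s < r) \<longrightarrow>
      (\<exists>g :: _ \<Rightarrow> nat. (\<forall>x. g x < R2) \<and>
        (\<forall>x y. g x = g y \<longleftrightarrow> (\<forall>s\<in>words k n1. f x s = f y s)))"
    by (rule exE[OF vector_colouring[OF finite_words]])
  obtain n2 where n2: "\<forall>c :: nat list \<Rightarrow> nat. (\<forall>w. c w < R2) \<longrightarrow> prefix_coloured k n2 c \<longrightarrow>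
     (\<exists>e\<in>template k m n2. \<forall>z\<in>words (Suc k) m. \<forall>z'\<in>words (Suc k) m.
        k \<in> set z \<longrightarrow> k \<in> set z' \<longrightarrow> first_index k z = first_index k z' \<longrightarrow> c (inst z e) = c (inst z' e))"
    by (rule exE[OF Suc.IH[of R2]])
  have "\<exists>e\<in>template k (Suc m) (n1 + n2). \<forall>z\<in>words (Suc k) (Suc m). \<forall>z'\<in>words (Suc k) (Suc m).
        k \<in> set z \<longrightarrow> k \<in> set z' \<longrightarrow> first_index k z = first_index k z' \<longrightarrow> c (inst z e) = c (inst z' e)"
    if c: "\<forall>w. c w < r" and pc: "prefix_coloured k (n1 + n2) c" for c :: "nat list \<Rightarrow> nat"
  proof -
    have pcD: "c z = c z'" if "z \<in> words (Suc k) (n1 + n2)" "z' \<in> words (Suc k) (n1 + n2)"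
      "k \<in> set z" "k \<in> set z'" "takeWhile (\<lambda>a. a \<noteq> k) z = takeWhile (\<lambda>a. a \<noteq> k) z'" for z z'
      using pc that unfolding prefix_coloured_def by blast
    obtain g where g: "\<forall>x. g x < R2"
      "\<forall>x y. g x = g y \<longleftrightarrow> (\<forall>w\<in>words k n1. c (w @ x) = c (w @ y))"
      using R2[rule_format, of "\<lambda>x w. c (w @ x)"] c by auto
    have "prefix_coloured k n2 g"
      unfolding prefix_coloured_def
    proof (intro ballI impI)
      fix z z' assume z: "z \<in> words (Suc k) n2" "z' \<in> words (Suc k) n2" "k \<in> set z" "k \<in> set z'"
        "takeWhile (\<lambda>a. a \<noteq> k) z = takeWhile (\<lambda>a. a \<noteq> k) z'"
      have "c (w @ z) = c (w @ z')" if w: "w \<in> words k n1" for w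
      proof (rule pcD)
        have w': "w \<in> words (Suc k) n1" using w words_mono[of k "Suc k"] by auto
        show "w @ z \<in> words (Suc k) (n1 + n2)" "w @ z' \<in> words (Suc k) (n1 + n2)"
          using append_words[OF w'] z by auto
        have "\<forall>a\<in>set w. a \<noteq> k" using w by (auto simp: words_def)
        then show "takeWhile (\<lambda>a. a \<noteq> k) (w @ z) = takeWhile (\<lambda>a. a \<noteq> k) (w @ z')"
          using z(5) by simp
      qed (use z in auto)
      then show "g z = g z'" using g(2) by blast
    qed
    then obtain e where e: "e \<in> template k m n2" and
      ge: "\<And>z z'. z \<in> words (Suc k) m \<Longrightarrow> z' \<in> words (Suc k) m \<Longrightarrow> k \<in> set z \<Longrightarrow> k \<in> set z' \<Longrightarrow>
        first_index k z = first_index k z' \<Longrightarrow> g (inst z e) = g (inst z' e)"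
      using n2 g(1) by metis
    define \<zeta> where "\<zeta> j = replicate j 0 @ replicate (m - j) k" for j
    have \<zeta>: "\<zeta> j \<in> words (Suc k) m" "k \<in> set (\<zeta> j)" "first_index k (\<zeta> j) = j" if "j < m" for j
      unfolding \<zeta>_def using first_index_probe[OF that k] by blast+
    obtain h where h: "\<forall>x. h x < R1"
      "\<forall>x y. h x = h y \<longleftrightarrow> (\<forall>j\<in>{..<m}. c (x @ inst (\<zeta> j) e) = c (y @ inst (\<zeta> j) e))"
      using R1[rule_format, of "\<lambda>x j. c (x @ inst (\<zeta> j) e)"] c by auto
    obtain l where l: "l \<in> template k 1 n1" "\<And>a. a < k \<Longrightarrow> h (inst [a] l) = h (inst [0] l)"
      using n1 h(1) by metis
    have low: "c (inst [a] l @ inst x e) = c (inst [0] l @ inst (\<zeta> (first_index k x)) e)"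
      if a: "a < k" and x: "x \<in> words (Suc k) m" "k \<in> set x" for a x
    proof -
      have j: "first_index k x < m" using first_index_less[OF x(2)] words_length[OF x(1)] by simp
      have "[a] \<in> words k 1" using a by (simp add: singleton_words)
      then have w: "inst [a] l \<in> words k n1" by (rule inst_words[OF l(1)])
      have "g (inst x e) = g (inst (\<zeta> (first_index k x)) e)"
        using x \<zeta>[OF j] by (intro ge) auto
      then have "c (inst [a] l @ inst x e) = c (inst [a] l @ inst (\<zeta> (first_index k x)) e)"
        using g(2) w by blast
      also have "\<dots> = c (inst [0] l @ inst (\<zeta> (first_index k x)) e)"
        using l(2)[OF a] h(2) j by blast
      finally show ?thesis .
    qed
    have high: "c (inst [k] l @ y) = c (inst [k] l @ y')"
      if y: "y \<in> words (Suc k) n2" "y' \<in> words (Suc k) n2" for y y'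
    proof (rule pcD)
      have kw: "[k] \<in> words (Suc k) 1" by (simp add: words_def)
      have k_in: "k \<in> set (inst [k] l)" by (rule letter_in_inst[OF l(1) kw]) simp
      have "inst [k] l \<in> words (Suc k) n1" by (rule inst_words_le[OF l(1) _ kw]) simp
      then show "inst [k] l @ y \<in> words (Suc k) (n1 + n2)" "inst [k] l @ y' \<in> words (Suc k) (n1 + n2)"
        using append_words y by auto
      show "k \<in> set (inst [k] l @ y)" "k \<in> set (inst [k] l @ y')" using k_in by auto
      show "takeWhile (\<lambda>a. a \<noteq> k) (inst [k] l @ y) = takeWhile (\<lambda>a. a \<noteq> k) (inst [k] l @ y')"
        using takeWhile_append1[OF k_in, of "\<lambda>a. a \<noteq> k"] by simp
    qed
    have inst_e: "inst (a # x) (l @ shift 1 e) = inst [a] l @ inst x e" for a x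
      using inst_append_shift[OF l(1), of "[a]" x e] by simp
    show ?thesis
    proof (intro bexI ballI impI)
      show "l @ shift 1 e \<in> template k (Suc m) (n1 + n2)"
        using append_shift_template[OF l(1) e] by simp
      fix z z' assume z: "z \<in> words (Suc k) (Suc m)" "z' \<in> words (Suc k) (Suc m)"
        "k \<in> set z" "k \<in> set z'" "first_index k z = first_index k z'"
      obtain a x where x: "z = a # x" "a < Suc k" "x \<in> words (Suc k) m"
        using words_Suc_cases[OF z(1)] .
      obtain a' x' where x': "z' = a' # x'" "a' < Suc k" "x' \<in> words (Suc k) m"
        using words_Suc_cases[OF z(2)] .
      show "c (inst z (l @ shift 1 e)) = c (inst z' (l @ shift 1 e))"
      proof (cases "a = k")
        case True
        then have "a' = k" using z(5) x x' by (simp add: first_index_Cons split: if_splits)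
        then show ?thesis
          using True high[OF inst_words_le[OF e _ x(3)] inst_words_le[OF e _ x'(3)]]
          unfolding x(1) x'(1) inst_e by (simp add: True \<open>a' = k\<close>)
      next
        case False
        then have "a' \<noteq> k" "first_index k x = first_index k x'" using z(5) x x' by (simp_all add: first_index_Cons split: if_splits)
        moreover have "k \<in> set x" "k \<in> set x'"
          using False \<open>a' \<noteq> k\<close> z(3,4) by (auto simp: x(1) x'(1))
        ultimately show ?thesis
          using False low[of a x] low[of a' x'] x x' unfolding x(1) x'(1) inst_e by simp
      qed
    qed
  qed
  then show ?case by blast
qed

text \<open>After both reductions the truth value depends only on which of \<open>2 * m\<close>
  variables first receives \<open>k\<close>. At least \<open>m\<close> of these positions agree;
  they are kept as variables.\<close>

lemma graham_rothschild_line: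
  assumes k: "k > 0"
  shows "\<exists>n. \<forall>P :: nat list \<Rightarrow> bool. \<exists>e\<in>template k m n.
     (\<forall>z\<in>words (Suc k) m. k \<in> set z \<longrightarrow> P (inst z e)) \<or>
     (\<forall>z\<in>words (Suc k) m. k \<in> set z \<longrightarrow> \<not> P (inst z e))"
proof -
  obtain M where M: "\<forall>c :: nat list \<Rightarrow> nat. (\<forall>w. c w < 2) \<longrightarrow> prefix_coloured k M c \<longrightarrow>
     (\<exists>e\<in>template k (2 * m) M. \<forall>z\<in>words (Suc k) (2 * m). \<forall>z'\<in>words (Suc k) (2 * m).
        k \<in> set z \<longrightarrow> k \<in> set z' \<longrightarrow> first_index k z = first_index k z' \<longrightarrow> c (inst z e) = c (inst z' e))"
    by (rule exE[OF first_index_subspace[OF k]])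
  obtain n where n: "\<forall>c :: nat list \<Rightarrow> nat. (\<forall>w. c w < 2) \<longrightarrow>
     (\<exists>e\<in>template k M n. prefix_coloured k M (\<lambda>z. c (inst z e)))"
    by (rule exE[OF prefix_coloured_subspace])
  have "\<exists>e\<in>template k m n.
     (\<forall>z\<in>words (Suc k) m. k \<in> set z \<longrightarrow> P (inst z e)) \<or>
     (\<forall>z\<in>words (Suc k) m. k \<in> set z \<longrightarrow> \<not> P (inst z e))" for P :: "nat list \<Rightarrow> bool"
  proof -
    define c where "c w = (of_bool (P w) :: nat)" for w
    have c: "c w < 2" "c w = c w' \<longleftrightarrow> P w = P w'" for w w' by (auto simp: c_def)
    obtain e0 where e0: "e0 \<in> template k M n" "prefix_coloured k M (\<lambda>z. c (inst z e0))"
      using n c(1) by blast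
    obtain e1 where e1: "e1 \<in> template k (2 * m) M" and
      ce1: "\<And>z z'. z \<in> words (Suc k) (2 * m) \<Longrightarrow> z' \<in> words (Suc k) (2 * m) \<Longrightarrow>
        k \<in> set z \<Longrightarrow> k \<in> set z' \<Longrightarrow> first_index k z = first_index k z' \<Longrightarrow> c (inst (inst z e1) e0) = c (inst (inst z' e1) e0)"
      using M[rule_format, of "\<lambda>z. c (inst z e0)"] e0(2) c(1) by blast
    define \<zeta> where "\<zeta> j = replicate j 0 @ replicate (2 * m - j) k" for j
    have \<zeta>: "\<zeta> j \<in> words (Suc k) (2 * m)" "k \<in> set (\<zeta> j)" "first_index k (\<zeta> j) = j" if "j < 2 * m" for j
      unfolding \<zeta>_def using first_index_probe[OF that k] by blast+
    define Q where "Q j = P (inst (inst (\<zeta> j) e1) e0)" for j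
    have PQ: "P (inst (inst z e1) e0) = Q (first_index k z)"
      if z: "z \<in> words (Suc k) (2 * m)" "k \<in> set z" for z
    proof -
      have j: "first_index k z < 2 * m" using first_index_less[OF z(2)] words_length[OF z(1)] by simp
      have "c (inst (inst z e1) e0) = c (inst (inst (\<zeta> (first_index k z)) e1) e0)"
        using z \<zeta>[OF j] by (intro ce1) auto
      then show ?thesis unfolding Q_def c(2) .
    qed
    obtain b J where J: "J \<subseteq> {..<2 * m}" "card J = m" "\<And>j. j \<in> J \<Longrightarrow> Q j = b"
    proof -
      have "card {j\<in>{..<2 * m}. Q j} + card {j\<in>{..<2 * m}. \<not> Q j} = 2 * m"
      proof -
        have "{j\<in>{..<2 * m}. Q j} \<union> {j\<in>{..<2 * m}. \<not> Q j} = {..<2 * m}" by auto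
        then show ?thesis
          using card_Un_disjoint[of "{j\<in>{..<2 * m}. Q j}" "{j\<in>{..<2 * m}. \<not> Q j}"] by fastforce
      qed
      then consider "m \<le> card {j\<in>{..<2 * m}. Q j}" | "m \<le> card {j\<in>{..<2 * m}. \<not> Q j}" by linarith
      then show ?thesis
      proof cases
        case 1
        then obtain J where "J \<subseteq> {j\<in>{..<2 * m}. Q j}" "card J = m"
          by (meson obtain_subset_with_card_n)
        then show ?thesis by (intro that[of J True]) auto
      next
        case 2
        then obtain J where "J \<subseteq> {j\<in>{..<2 * m}. \<not> Q j}" "card J = m"
          by (meson obtain_subset_with_card_n)
        then show ?thesis by (intro that[of J False]) auto
      qed
    qed
    have "finite J" using J(1) finite_subset by blast
    then obtain \<beta> where \<beta>: "bij_betw \<beta> J {..<m}"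
      using J(2) ex_bij_betw_finite_nat[of J] by (auto simp: atLeast0LessThan)
    \<comment> \<open>Positions outside \<open>J\<close> are frozen at 0, which differs from
      \<open>k\<close>, so the first \<open>k\<close> always falls in \<open>J\<close>. As
      \<open>Q\<close> is constant on \<open>J\<close>, any numbering \<open>\<beta>\<close> of its
      elements will do.\<close>
    define f :: "(nat + nat) list" where
      "f = map (\<lambda>j. if j \<in> J then Inr (\<beta> j) else Inl 0) [0..<2 * m]"
    have f: "f \<in> template k m (2 * m)"
    proof (rule templateI)
      show "length f = 2 * m" by (simp add: f_def)
    next
      fix s assume "s \<in> set f"
      then show "(\<exists>a<k. s = Inl a) \<or> (\<exists>i<m. s = Inr i)"
        using k bij_betwE[OF \<beta>] by (auto simp: f_def)
    next
      fix i assume "i < m"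
      then obtain j where j: "j \<in> J" "\<beta> j = i"
        using \<beta> by (metis bij_betw_iff_bijections lessThan_iff)
      then show "Inr i \<in> set f"
        using J(1) by (auto simp: f_def image_iff intro!: bexI[of _ j])
    qed
    have inst_f: "Q (first_index k (inst z f)) = b \<and> inst z f \<in> words (Suc k) (2 * m) \<and> k \<in> set (inst z f)"
      if z: "z \<in> words (Suc k) m" "k \<in> set z" for z
    proof -
      have k_in: "k \<in> set (inst z f)" by (rule letter_in_inst[OF f z])
      have lt: "first_index k (inst z f) < 2 * m" using first_index_less[OF k_in] template_length[OF f] by simp
      have "first_index k (inst z f) \<in> J"
      proof (rule ccontr)
        assume "first_index k (inst z f) \<notin> J"
        then have "inst z f ! first_index k (inst z f) = 0" using lt by (simp add: f_def inst_def)
        then show False using nth_first_index[OF k_in] k by simp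
      qed
      then show ?thesis using J(3) k_in inst_words_le[OF f _ z(1)] by auto
    qed
    have e1': "compose f e1 \<in> template k m M" by (rule compose_template[OF f e1])
    have "P (inst z (compose (compose f e1) e0)) = b" if "z \<in> words (Suc k) m" "k \<in> set z" for z
      using inst_f[OF that] PQ[of "inst z f"] inst_compose[OF e0(1) template_length[OF e1']]
        inst_compose[OF e1 template_length[OF f]] by simp
    then show ?thesis
      using compose_template[OF e1' e0(1)] by (cases b) blast+
  qed
  then show ?thesis by blast
qed

section \<open>The density Hales--Jewett theorem\<close>

subsection \<open>Insensitive sets\<close>

text \<open>Membership in an insensitive set does not change when letters \<open>k\<close> are exchanged with letters \<open>r\<close>.\<close>

definition insensitive :: "nat \<Rightarrow> nat \<Rightarrow> nat \<Rightarrow> (nat list \<Rightarrow> bool) \<Rightarrow> bool" where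
  "insensitive k r n E \<longleftrightarrow> (\<forall>z\<in>words (Suc k) n. E z = E (replace k r z))"

text \<open>The template with fixed letter \<open>k\<close> at the zeros of \<open>p\<close> and a new variable at every one: summing
  over \<open>p\<close> decomposes \<open>{0..k}\<^sup>s\<close> according to the positions of the letter \<open>k\<close>.\<close>

primrec pattern :: "nat \<Rightarrow> nat list \<Rightarrow> (nat + nat) list" where
  "pattern k [] = []"
| "pattern k (b # p) = (if b = 0 then Inl k # pattern k p else Inr 0 # shift 1 (pattern k p))"

lemma pattern_template: "p \<in> words 2 s \<Longrightarrow> pattern k p \<in> template (Suc k) (sum_list p) s"
proof (induction s arbitrary: p)
  case (Suc s)
  obtain b q where p: "p = b # q" "b < 2" "q \<in> words 2 s"
    using words_Suc_cases[OF Suc.prems] .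
  have IH: "pattern k q \<in> template (Suc k) (sum_list q) s" by (rule Suc.IH[OF p(3)])
  show ?case
  proof (cases "b = 0")
    case True
    have "map Inl [k] @ pattern k q \<in> template (Suc k) (sum_list q) (1 + s)"
      by (rule Inl_append_template[OF _ IH]) (simp add: words_def)
    then show ?thesis using True p(1) by simp
  next
    case False
    then have "b = 1" using p(2) by simp
    then show ?thesis using Cons_shift_template[OF IH] p(1) by simp
  qed
qed (simp add: template_def)

lemma sum_words_pattern:
  fixes f :: "nat list \<Rightarrow> real"
  shows "(\<Sum>z\<in>words (Suc k) s. f z)
    = (\<Sum>p\<in>words 2 s. \<Sum>w\<in>words k (sum_list p). f (inst w (pattern k p)))"
proof (induction s arbitrary: f)
  case 0
  show ?case by (simp add: inst_def)
next
  case (Suc s)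
  have two: "{..<2::nat} = {0, 1}" by auto
  have sb0: "inst w (Inl k # t) = k # inst w t" for w t by (simp add: inst_def)
  have "(\<Sum>p\<in>words 2 (Suc s). \<Sum>w\<in>words k (sum_list p). f (inst w (pattern k p)))
      = (\<Sum>p\<in>words 2 s. \<Sum>w\<in>words k (sum_list p). f (k # inst w (pattern k p)))
        + (\<Sum>p\<in>words 2 s. \<Sum>w\<in>words k (Suc (sum_list p)). f (inst w (Inr 0 # shift 1 (pattern k p))))"
    by (simp add: sum_words_Suc[of _ 2] two sb0 sum.distrib)
  also have "(\<Sum>p\<in>words 2 s. \<Sum>w\<in>words k (Suc (sum_list p)). f (inst w (Inr 0 # shift 1 (pattern k p))))
      = (\<Sum>p\<in>words 2 s. \<Sum>a<k. \<Sum>w\<in>words k (sum_list p). f (a # inst w (pattern k p)))"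
    unfolding sum_words_Suc[of _ k] inst_Cons_shift ..
  also have "\<dots> = (\<Sum>a<k. \<Sum>z\<in>words (Suc k) s. f (a # z))"
    by (subst sum.swap) (simp add: Suc.IH[of "\<lambda>z. f (_ # z)"])
  finally show ?case
    using Suc.IH[of "\<lambda>z. f (k # z)"] by (simp add: sum_words_Suc[of f "Suc k"])
qed

lemma sum_words_2_power: "(\<Sum>p\<in>words 2 s. (y::real) ^ sum_list p) = (1 + y) ^ s"
proof (induction s)
  case (Suc s)
  then show ?case
    by (simp add: sum_words_Suc numeral_2_eq_2 sum_distrib_left[symmetric] algebra_simps)
qed simp

text \<open>Fixing the positions of \<open>k\<close> leaves words over \<open>k\<close> letters.
  Position sets with few free places have negligible weight, so some large one carries density and
  contains a subspace over \<open>k\<close> letters. Insensitivity then admits the value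
  \<open>k\<close> for its variables.\<close>

lemma dense_insensitive_subspace:
  assumes k: "k > 0" and dhj: "\<And>\<delta>. \<delta> > 0 \<Longrightarrow> dhj k d \<delta>" and \<epsilon>: "\<epsilon> > 0"
  obtains s where "\<And>r E. r < k \<Longrightarrow> insensitive k r s E \<Longrightarrow> \<epsilon> \<le> avg (Suc k) s (\<lambda>z. of_bool (E z)) \<Longrightarrow>
      \<exists>t\<in>template (Suc k) d s. \<forall>z\<in>words (Suc k) d. E (inst z t)"
proof -
  obtain N where N: "\<And>n A. N \<le> n \<Longrightarrow> \<epsilon> / 2 \<le> avg k n (\<lambda>w. of_bool (A w)) \<Longrightarrow>
      \<exists>t\<in>template k d n. \<forall>z\<in>words k d. A (inst z t)"
    using dhjE[OF dhj[of "\<epsilon> / 2"]] \<epsilon> by auto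
  have "(\<lambda>s. 2 ^ N * (3 / 4 :: real) ^ s) \<longlonglongrightarrow> 2 ^ N * 0"
    by (intro tendsto_mult_left LIMSEQ_power_zero) auto
  then have "eventually (\<lambda>s. 2 ^ N * (3 / 4 :: real) ^ s < \<epsilon> / 2) sequentially"
    by (rule order_tendstoD(2)) (use \<epsilon> in simp)
  then obtain s where s: "2 ^ N * (3 / 4 :: real) ^ s < \<epsilon> / 2"
    by (auto simp: eventually_sequentially)
  have "\<exists>t\<in>template (Suc k) d s. \<forall>z\<in>words (Suc k) d. E (inst z t)"
    if r: "r < k" and E: "insensitive k r s E" and dense: "\<epsilon> \<le> avg (Suc k) s (\<lambda>z. of_bool (E z))" for r E
  proof -
    have "\<exists>p\<in>words 2 s. N \<le> sum_list p \<and>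
        \<epsilon> / 2 \<le> avg k (sum_list p) (\<lambda>w. of_bool (E (inst w (pattern k p))))"
    proof (rule ccontr)
      assume neg: "\<not> ?thesis"
      \<comment> \<open>An exponential weight for patterns with fewer than \<open>N\<close> free
        places: there \<open>k ^ p\<close> is at most \<open>2 ^ N * (k / 2) ^ p\<close>. Summed
        over all patterns this gives \<open>2 ^ N * (1 + k / 2) ^ s\<close>, and
        \<open>1 + k / 2\<close> is at most \<open>3 / 4 * (1 + k)\<close> as \<open>k\<close> is
        positive; hence the ratio \<open>3 / 4\<close>.\<close>
      have le: "(\<Sum>w\<in>words k (sum_list p). of_bool (E (inst w (pattern k p))))
          \<le> \<epsilon> / 2 * real k ^ sum_list p + 2 ^ N * (real k / 2) ^ sum_list p" (is "?S p \<le> _")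
        if "p \<in> words 2 s" for p
      proof (cases "N \<le> sum_list p")
        case True
        then have "avg k (sum_list p) (\<lambda>w. of_bool (E (inst w (pattern k p)))) \<le> \<epsilon> / 2"
          using neg that by fastforce
        then have "?S p \<le> \<epsilon> / 2 * real k ^ sum_list p"
          using k by (simp add: avg_def divide_le_eq)
        then show ?thesis by (simp add: add_increasing2)
      next
        case False
        have "?S p \<le> (\<Sum>w\<in>words k (sum_list p). 1)"
          by (intro sum_mono) auto
        also have "\<dots> = 2 ^ sum_list p * (real k / 2) ^ sum_list p"
          by (simp add: card_words power_divide)
        also have "\<dots> \<le> 2 ^ N * (real k / 2) ^ sum_list p"
          using False by (intro mult_right_mono power_increasing) auto
        finally show ?thesis using \<epsilon> by (simp add: add_increasing)
      qed
      have "(\<Sum>z\<in>words (Suc k) s. of_bool (E z))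
          \<le> (\<Sum>p\<in>words 2 s. \<epsilon> / 2 * real k ^ sum_list p + 2 ^ N * (real k / 2) ^ sum_list p)"
        unfolding sum_words_pattern[of "\<lambda>z. of_bool (E z)"] by (intro sum_mono le)
      also have "\<dots> = \<epsilon> / 2 * (1 + real k) ^ s + 2 ^ N * (1 + real k / 2) ^ s"
        by (simp only: sum.distrib sum_distrib_left[symmetric] sum_words_2_power)
      also have "(1 + real k / 2) ^ s \<le> (3 / 4 * (1 + real k)) ^ s"
        using k by (intro power_mono) (auto simp: field_simps)
      also have "\<epsilon> / 2 * (1 + real k) ^ s + 2 ^ N * (3 / 4 * (1 + real k)) ^ s
          = (\<epsilon> / 2 + 2 ^ N * (3 / 4) ^ s) * (1 + real k) ^ s"
        by (simp only: power_mult_distrib distrib_right mult.assoc)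
      also have "\<dots> < \<epsilon> * (1 + real k) ^ s"
        using s by (intro mult_strict_right_mono) auto
      finally have "avg (Suc k) s (\<lambda>z. of_bool (E z)) < \<epsilon>"
        by (simp add: avg_def divide_less_eq add.commute)
      then show False using dense by simp
    qed
    then obtain p where p: "p \<in> words 2 s" "N \<le> sum_list p"
      "\<epsilon> / 2 \<le> avg k (sum_list p) (\<lambda>w. of_bool (E (inst w (pattern k p))))"
      by blast
    obtain t where t: "t \<in> template k d (sum_list p)" "\<And>z. z \<in> words k d \<Longrightarrow> E (inst (inst z t) (pattern k p))"
      using N[OF p(2,3)] by blast
    have t': "t \<in> template (Suc k) d (sum_list p)" using t(1) template_mono[of k "Suc k"] by auto
    have q: "pattern k p \<in> template (Suc k) (sum_list p) s" by (rule pattern_template[OF p(1)])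
    define u where "u = compose t (pattern k p)"
    have u: "u \<in> template (Suc k) d s" unfolding u_def by (rule compose_template[OF t' q])
    have "E (inst z u)" if z: "z \<in> words (Suc k) d" for z
    proof -
      have "E (inst (replace k r z) u)"
        using t(2)[OF replace_words[OF z r]] unfolding u_def inst_compose[OF q template_length[OF t']] .
      moreover have "E (inst (replace k r z) u) = E (replace k r (inst (replace k r z) u))"
        using E inst_words[OF u replace_words_Suc[OF z r]] unfolding insensitive_def by blast
      moreover have "E (inst z u) = E (replace k r (inst z u))"
        using E inst_words[OF u z] unfolding insensitive_def by blast
      ultimately show ?thesis
        using replace_inst_replace[OF u words_length[OF z], of k r] by simp
    qed
    then show ?thesis using u by blast
  qed
  then show ?thesis by (rule that)
qed

text \<open>A greedy tiling. In each fibre over the last \<open>s\<close> coordinates where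
  \<open>E\<close> is dense, one \<open>d\<close>-dimensional subspace inside \<open>E\<close> is
  removed; \<open>g\<close> has nonpositive sum on it. The remainder is treated in the first
  coordinates, and each round shrinks the excess of the density over \<open>\<epsilon>\<close> by a
  fixed factor.\<close>

lemma insensitive_sum_recursion:
  assumes r: "r < k" and \<epsilon>: "\<epsilon> \<ge> 0"
    and s: "\<And>E. insensitive k r s E \<Longrightarrow> \<epsilon> \<le> avg (Suc k) s (\<lambda>z. of_bool (E z)) \<Longrightarrow>
      \<exists>t\<in>template (Suc k) d s. \<forall>z\<in>words (Suc k) d. E (inst z t)"
  shows "j * s \<le> n \<Longrightarrow> insensitive k r n E \<Longrightarrow> (\<And>z. g z \<le> 1) \<Longrightarrow>
    (\<And>t. t \<in> template (Suc k) d n \<Longrightarrow> avg (Suc k) d (\<lambda>z. g (inst z t)) \<le> 0) \<Longrightarrow>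
    avg (Suc k) n (\<lambda>z. of_bool (E z) * g z) - \<epsilon>
      \<le> (1 - 1 / real (Suc k) ^ s) ^ j * (avg (Suc k) n (\<lambda>z. of_bool (E z)) - \<epsilon>)"
proof (induction j arbitrary: n E g)
  case 0
  then show ?case by (auto intro!: avg_mono simp: of_bool_def)
next
  case (Suc j)
  note E = Suc.prems(2) and g = Suc.prems(3) and sub = Suc.prems(4)
  define K where "K = Suc k"
  define \<kappa> where "\<kappa> = 1 / real K ^ s"
  define n' where "n' = n - s"
  have n: "n = n' + s" "j * s \<le> n'" using Suc.prems(1) by (auto simp: n'_def)
  have K: "K > 0" by (simp add: K_def)
  have \<kappa>: "0 \<le> \<kappa>" "\<kappa> \<le> 1" by (auto simp: \<kappa>_def K_def divide_le_eq)
  have E_replace: "E (x @ y) = E (x' @ y')"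
    if "x \<in> words K n'" "x' \<in> words K n'" "y \<in> words K s" "y' \<in> words K s"
      "replace k r x = replace k r x'" "replace k r y = replace k r y'" for x x' y y'
  proof -
    have "E (x @ y) = E (replace k r (x @ y))" "E (x' @ y') = E (replace k r (x' @ y'))"
      using E append_words[OF that(1,3)] append_words[OF that(2,4)]
      unfolding insensitive_def n(1) K_def by blast+
    then show ?thesis using that(5,6) by (simp add: replace_append)
  qed
  have repK: "replace k r x \<in> words K m" if "x \<in> words K m" for x m
    using replace_words_Suc[OF _ r] that unfolding K_def by blast
  \<comment> \<open>Membership in \<open>words K s\<close> is built in so that fibres agreeing on
    words are equal as functions.\<close>
  define F where "F x = (\<lambda>y. y \<in> words K s \<and> E (x @ y))" for x
  \<comment> \<open>The subspace is chosen from the fibre alone, not from \<open>x\<close>, so the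
    removed part is itself insensitive in \<open>x\<close>.\<close>
  define T where "T G = (SOME t. t \<in> template K d s \<and> (\<forall>z\<in>words K d. G (inst z t)))" for G
  define D where "D G \<longleftrightarrow> \<epsilon> \<le> avg K s (\<lambda>y. of_bool (G y))" for G
  define H where "H x y \<longleftrightarrow> D (F x) \<and> y \<in> (\<lambda>z. inst z (T (F x))) ` words K d" for x y
  have F_replace: "F (replace k r x) = F x" if "x \<in> words K n'" for x
  proof
    show "F (replace k r x) y = F x y" for y
      unfolding F_def using E_replace[OF repK[OF that] that, of y y] by (auto simp: replace_replace)
  qed
  have T: "T (F x) \<in> template K d s" "\<And>z. z \<in> words K d \<Longrightarrow> F x (inst z (T (F x)))"
    if x: "x \<in> words K n'" and "D (F x)" for x
  proof -
    have "insensitive k r s (F x)"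
      unfolding insensitive_def K_def[symmetric]
    proof
      fix y assume y: "y \<in> words K s"
      show "F x y = F x (replace k r y)"
        using E_replace[OF x x y repK[OF y]] y repK[OF y] by (simp add: F_def replace_replace)
    qed
    then have "\<exists>t. t \<in> template K d s \<and> (\<forall>z\<in>words K d. F x (inst z t))"
      using s[of "F x"] that(2) unfolding D_def K_def by blast
    then have "T (F x) \<in> template K d s \<and> (\<forall>z\<in>words K d. F x (inst z (T (F x))))"
      unfolding T_def by (rule someI_ex)
    then show "T (F x) \<in> template K d s" "\<And>z. z \<in> words K d \<Longrightarrow> F x (inst z (T (F x)))" by blast+
  qed
  have HE: "E (x @ y)" if "H x y" "x \<in> words K n'" for x y
    using that T(2)[of x] unfolding H_def F_def by auto
  have Hg: "avg K s (\<lambda>y. of_bool (H x y) * g (x @ y)) \<le> 0" if x: "x \<in> words K n'" for x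
  proof (cases "D (F x)")
    case False
    then show ?thesis by (simp add: H_def avg_def)
  next
    case True
    define t where "t = T (F x)"
    have t: "t \<in> template K d s" unfolding t_def by (rule T(1)[OF x True])
    have inj: "inj_on (\<lambda>z. inst z t) (words K d)"
      by (rule inj_onI, rule inst_inj[OF t]) (auto simp: words_length)
    have im: "(\<lambda>z. inst z t) ` words K d \<subseteq> words K s" using inst_words[OF t] by blast
    have "(\<Sum>y\<in>words K s. of_bool (H x y) * g (x @ y))
        = (\<Sum>y\<in>(\<lambda>z. inst z t) ` words K d. of_bool (H x y) * g (x @ y))"
      by (rule sum.mono_neutral_right) (use im in \<open>auto simp: H_def t_def\<close>)
    also have "\<dots> = (\<Sum>z\<in>words K d. g (x @ inst z t))"
      unfolding sum.reindex[OF inj] using True by (intro sum.cong) (auto simp: H_def t_def)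
    also have "\<dots> = (\<Sum>z\<in>words K d. g (inst z (map Inl x @ t)))"
      by (simp add: inst_append)
    also have "\<dots> \<le> 0"
      using sub[of "map Inl x @ t"] Inl_append_template[OF x t] K
      by (simp add: n(1) K_def[symmetric] avg_def divide_le_eq)
    finally show ?thesis by (simp add: avg_def divide_le_eq K)
  qed
  \<comment> \<open>A single point of the removed subspace already has weight
    \<open>\<kappa>\<close> in its fibre.\<close>
  have H_ge: "\<kappa> * of_bool (D (F x)) \<le> avg K s (\<lambda>y. of_bool (H x y))" if x: "x \<in> words K n'" for x
  proof (cases "D (F x)")
    case True
    define y where "y = inst (replicate d 0) (T (F x))"
    have z: "replicate d 0 \<in> words K d" by (rule replicate_words[OF K])
    have y: "y \<in> words K s" unfolding y_def by (rule inst_words[OF T(1)[OF x True] z])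
    have "H x y" using True z unfolding H_def y_def by blast
    moreover have "of_bool (H x y) \<le> (\<Sum>y\<in>words K s. of_bool (H x y) :: real)"
      by (rule member_le_sum[OF y]) auto
    ultimately show ?thesis
      using True K by (simp add: avg_def \<kappa>_def divide_right_mono)
  qed (simp add: avg_def sum_nonneg)
  \<comment> \<open>Removing subspaces destroys insensitivity in \<open>y\<close>, so
    \<open>y\<close> is frozen and the recursion continues in \<open>x\<close> only.\<close>
  define E' where "E' y x \<longleftrightarrow> E (x @ y) \<and> \<not> H x y" for y x
  have split: "of_bool (E (x @ y)) = (of_bool (E' y x) + of_bool (H x y) :: real)"
    if "x \<in> words K n'" for x y
    using HE[OF _ that] by (auto simp: E'_def)
  have "insensitive k r n' (E' y)" if y: "y \<in> words K s" for y
    unfolding insensitive_def K_def[symmetric]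
  proof
    fix x assume x: "x \<in> words K n'"
    show "E' y x = E' y (replace k r x)"
      using E_replace[OF x repK[OF x] y y] F_replace[OF x] by (simp add: E'_def H_def replace_replace)
  qed
  then have IH: "avg K n' (\<lambda>x. of_bool (E' y x) * g (x @ y))
      \<le> \<epsilon> + (1 - \<kappa>) ^ j * (avg K n' (\<lambda>x. of_bool (E' y x)) - \<epsilon>)" if y: "y \<in> words K s" for y
    using Suc.IH[OF n(2), of "E' y" "\<lambda>x. g (x @ y)"] y g sub[of "_ @ map Inl y"]
      append_Inl_template[of y K s _ d n']
    by (simp add: K_def[symmetric] \<kappa>_def inst_append n(1) algebra_simps)
  have "avg K n (\<lambda>z. of_bool (E z) * g z)
      = avg K n' (\<lambda>x. avg K s (\<lambda>y. of_bool (E' y x) * g (x @ y) + of_bool (H x y) * g (x @ y)))"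
    unfolding n(1) avg_append by (intro avg_cong) (simp add: split algebra_simps)
  also have "\<dots> = avg K n' (\<lambda>x. avg K s (\<lambda>y. of_bool (E' y x) * g (x @ y)))
      + avg K n' (\<lambda>x. avg K s (\<lambda>y. of_bool (H x y) * g (x @ y)))"
    unfolding avg_add ..
  also have "avg K n' (\<lambda>x. avg K s (\<lambda>y. of_bool (H x y) * g (x @ y))) \<le> 0"
    by (rule avg_le_const[OF K Hg])
  also have "avg K n' (\<lambda>x. avg K s (\<lambda>y. of_bool (E' y x) * g (x @ y)))
      = avg K s (\<lambda>y. avg K n' (\<lambda>x. of_bool (E' y x) * g (x @ y)))"
    by (rule avg_swap)
  \<comment> \<open>The inductive bound is affine in the density of \<open>E' y\<close>, also when
    the excess over \<open>\<epsilon>\<close> is negative, so averaging over \<open>y\<close>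
    preserves its form.\<close>
  also have "\<dots> \<le> avg K s (\<lambda>y. \<epsilon> + (1 - \<kappa>) ^ j * (avg K n' (\<lambda>x. of_bool (E' y x)) - \<epsilon>))"
    by (intro avg_mono IH)
  also have "\<dots> = \<epsilon> + (1 - \<kappa>) ^ j * (avg K s (\<lambda>y. avg K n' (\<lambda>x. of_bool (E' y x))) - \<epsilon>)"
    by (simp add: avg_add avg_cmult avg_diff K)
  also have "avg K s (\<lambda>y. avg K n' (\<lambda>x. of_bool (E' y x)))
      = avg K n' (\<lambda>x. avg K s (\<lambda>y. of_bool (E (x @ y)) - of_bool (H x y)))"
    by (subst avg_swap) (intro avg_cong, simp add: split)
  also have "\<dots> = avg K n (\<lambda>z. of_bool (E z)) - avg K n' (\<lambda>x. avg K s (\<lambda>y. of_bool (H x y)))"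
    unfolding n(1) avg_append avg_diff ..
  finally have 1: "avg K n (\<lambda>z. of_bool (E z) * g z) - \<epsilon> \<le> (1 - \<kappa>) ^ j *
      (avg K n (\<lambda>z. of_bool (E z)) - avg K n' (\<lambda>x. avg K s (\<lambda>y. of_bool (H x y))) - \<epsilon>)"
    by simp
  have "\<kappa> * (avg K n (\<lambda>z. of_bool (E z)) - \<epsilon>) \<le> \<kappa> * avg K n' (\<lambda>x. of_bool (D (F x)))"
  proof (rule mult_left_mono[OF _ \<kappa>(1)])
    have "avg K n (\<lambda>z. of_bool (E z)) = avg K n' (\<lambda>x. avg K s (\<lambda>y. of_bool (F x y)))"
      unfolding n(1) avg_append by (intro avg_cong) (simp add: F_def)
    then show "avg K n (\<lambda>z. of_bool (E z)) - \<epsilon> \<le> avg K n' (\<lambda>x. of_bool (D (F x)))"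
      using avg_markov[OF K, of n' "\<lambda>x. avg K s (\<lambda>y. of_bool (F x y))" \<epsilon>] \<epsilon> avg_le_const[OF K]
      unfolding D_def by auto
  qed
  also have "\<dots> \<le> avg K n' (\<lambda>x. avg K s (\<lambda>y. of_bool (H x y)))"
    unfolding avg_cmult[symmetric] by (intro avg_mono H_ge)
  finally have "(1 - \<kappa>) ^ j *
      (avg K n (\<lambda>z. of_bool (E z)) - avg K n' (\<lambda>x. avg K s (\<lambda>y. of_bool (H x y))) - \<epsilon>)
      \<le> (1 - \<kappa>) ^ j * ((1 - \<kappa>) * (avg K n (\<lambda>z. of_bool (E z)) - \<epsilon>))"
    using \<kappa> by (intro mult_left_mono) (auto simp: algebra_simps)
  then show ?case
    using 1 unfolding K_def[symmetric] \<kappa>_def[symmetric] by (simp add: mult_ac)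
qed

text \<open>An insensitive set is a disjoint union of \<open>d\<close>-dimensional subspaces up to a
  small error, so a function with nonpositive mean on every such subspace has almost nonpositive sum
  over it.\<close>

lemma insensitive_sum_le:
  assumes k: "k > 0" and dhj: "\<And>\<delta>. \<delta> > 0 \<Longrightarrow> dhj k d \<delta>" and \<epsilon>: "\<epsilon> > 0"
  shows "\<exists>N. \<forall>n\<ge>N. \<forall>r E g. r < k \<longrightarrow> insensitive k r n E \<longrightarrow> (\<forall>z. g z \<le> 1) \<longrightarrow>
    (\<forall>t\<in>template (Suc k) d n. avg (Suc k) d (\<lambda>z. g (inst z t)) \<le> 0) \<longrightarrow>
    avg (Suc k) n (\<lambda>z. of_bool (E z) * g z) \<le> \<epsilon>"
proof -
  obtain s where s: "\<And>r E. r < k \<Longrightarrow> insensitive k r s E \<Longrightarrow>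
      \<epsilon> / 2 \<le> avg (Suc k) s (\<lambda>z. of_bool (E z)) \<Longrightarrow>
      \<exists>t\<in>template (Suc k) d s. \<forall>z\<in>words (Suc k) d. E (inst z t)"
    using dense_insensitive_subspace[OF k dhj, of "\<epsilon> / 2"] \<epsilon> by auto
  define \<rho> where "\<rho> = 1 - 1 / real (Suc k) ^ s"
  have \<rho>: "0 \<le> \<rho>" "\<rho> < 1" by (auto simp: \<rho>_def divide_le_eq)
  then obtain j where j: "\<rho> ^ j < \<epsilon> / 2"
    using real_arch_pow_inv[of "\<epsilon> / 2" \<rho>] \<epsilon> by auto
  have "avg (Suc k) n (\<lambda>z. of_bool (E z) * g z) \<le> \<epsilon>"
    if n: "j * s \<le> n" and r: "r < k" and E: "insensitive k r n E" and g: "\<forall>z. g z \<le> 1"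
      and sub: "\<forall>t\<in>template (Suc k) d n. avg (Suc k) d (\<lambda>z. g (inst z t)) \<le> 0" for n r E g
  proof -
    have "avg (Suc k) n (\<lambda>z. of_bool (E z) * g z) - \<epsilon> / 2
        \<le> \<rho> ^ j * (avg (Suc k) n (\<lambda>z. of_bool (E z)) - \<epsilon> / 2)"
      unfolding \<rho>_def
      by (rule insensitive_sum_recursion[OF r _ s[OF r] n E]) (use \<epsilon> g sub in auto)
    also have "\<dots> \<le> \<rho> ^ j * 1"
    proof (rule mult_left_mono)
      have "avg (Suc k) n (\<lambda>z. of_bool (E z)) \<le> 1" by (intro avg_le_const) auto
      then show "avg (Suc k) n (\<lambda>z. of_bool (E z)) - \<epsilon> / 2 \<le> 1" using \<epsilon> by simp
    qed (use \<rho> in simp)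
    finally show ?thesis using j by simp
  qed
  then show ?thesis by blast
qed

text \<open>The dimensions are nested: the intersection of the first \<open>q\<close> sets is
  controlled inside each \<open>d'\<close>-dimensional subspace, and the last set is tiled by such
  subspaces.\<close>

lemma insensitive_intersection_sum_le:
  fixes q :: nat
  assumes k: "k > 0" and dhj: "\<And>d \<delta>. \<delta> > 0 \<Longrightarrow> dhj k d \<delta>" and "\<epsilon> > 0"
  shows "\<exists>N. \<forall>n\<ge>N. \<forall>r E g. (\<forall>i<q. r i < k \<and> insensitive k (r i) n (E i)) \<longrightarrow> (\<forall>z. g z \<le> 1) \<longrightarrow>
    (\<forall>t\<in>template (Suc k) d n. avg (Suc k) d (\<lambda>z. g (inst z t)) \<le> 0) \<longrightarrow>
    avg (Suc k) n (\<lambda>z. of_bool (\<forall>i<q. E i z) * g z) \<le> \<epsilon>"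
  using \<open>\<epsilon> > 0\<close>
proof (induction q arbitrary: \<epsilon>)
  case 0
  obtain N where N: "\<forall>n\<ge>N. \<forall>r E g. r < k \<longrightarrow> insensitive k r n E \<longrightarrow> (\<forall>z. g z \<le> 1) \<longrightarrow>
    (\<forall>t\<in>template (Suc k) d n. avg (Suc k) d (\<lambda>z. g (inst z t)) \<le> 0) \<longrightarrow>
    avg (Suc k) n (\<lambda>z. of_bool (E z) * g z) \<le> \<epsilon>"
    by (rule exE[OF insensitive_sum_le[OF k dhj 0]])
  have "insensitive k 0 n (\<lambda>z. \<forall>i<0. E i z)" for n and E :: "nat \<Rightarrow> nat list \<Rightarrow> bool"
    by (simp add: insensitive_def)
  then show ?case using N k by blast
next
  case (Suc q)
  have \<epsilon>2: "\<epsilon> / 2 > 0" using Suc.prems by simp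
  obtain d' where d': "\<forall>n\<ge>d'. \<forall>r E g. (\<forall>i<q. r i < k \<and> insensitive k (r i) n (E i)) \<longrightarrow> (\<forall>z. g z \<le> 1) \<longrightarrow>
    (\<forall>t\<in>template (Suc k) d n. avg (Suc k) d (\<lambda>z. g (inst z t)) \<le> 0) \<longrightarrow>
    avg (Suc k) n (\<lambda>z. of_bool (\<forall>i<q. E i z) * g z) \<le> \<epsilon> / 2"
    by (rule exE[OF Suc.IH[OF \<epsilon>2]])
  obtain N where N: "\<forall>n\<ge>N. \<forall>r E g. r < k \<longrightarrow> insensitive k r n E \<longrightarrow> (\<forall>z. g z \<le> 1) \<longrightarrow>
    (\<forall>t\<in>template (Suc k) d' n. avg (Suc k) d' (\<lambda>z. g (inst z t)) \<le> 0) \<longrightarrow>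
    avg (Suc k) n (\<lambda>z. of_bool (E z) * g z) \<le> \<epsilon> / 2"
    by (rule exE[OF insensitive_sum_le[OF k dhj \<epsilon>2]])
  have "avg (Suc k) n (\<lambda>z. of_bool (\<forall>i<Suc q. E i z) * g z) \<le> \<epsilon>"
    if n: "n \<ge> N" and E: "\<forall>i<Suc q. r i < k \<and> insensitive k (r i) n (E i)" and g: "\<forall>z. g z \<le> 1"
      and sub: "\<forall>t\<in>template (Suc k) d n. avg (Suc k) d (\<lambda>z. g (inst z t)) \<le> 0"
    for n r g and E :: "nat \<Rightarrow> nat list \<Rightarrow> bool"
  proof -
    \<comment> \<open>Subtracting \<open>\<epsilon> / 2\<close> turns the bound of the induction
      hypothesis on subspaces into the nonpositivity required for the last set.\<close>
    define h where "h z = of_bool (\<forall>i<q. E i z) * g z - \<epsilon> / 2" for z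
    have h1: "h z \<le> 1" for z using g[rule_format, of z] \<epsilon>2 by (simp add: h_def)
    have "avg (Suc k) d' (\<lambda>z. h (inst z t)) \<le> 0" if t: "t \<in> template (Suc k) d' n" for t
    proof -
      have "insensitive k (r i) d' (\<lambda>z. E i (inst z t))" if i: "i < q" for i
        unfolding insensitive_def
      proof
        fix z assume z: "z \<in> words (Suc k) d'"
        have ri: "r i < k" "insensitive k (r i) n (E i)" using E i by auto
        have "E i (inst z t) = E i (replace k (r i) (inst z t))"
          "E i (inst (replace k (r i) z) t) = E i (replace k (r i) (inst (replace k (r i) z) t))"
          using ri(2) inst_words[OF t z] inst_words[OF t replace_words_Suc[OF z ri(1)]]
          unfolding insensitive_def by blast+
        then show "E i (inst z t) = E i (inst (replace k (r i) z) t)"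
          using replace_inst_replace[OF t words_length[OF z]] by simp
      qed
      moreover have "avg (Suc k) d (\<lambda>z. g (inst (inst z u) t)) \<le> 0" if u: "u \<in> template (Suc k) d d'" for u
        using sub compose_template[OF u t] inst_compose[OF t template_length[OF u]] by force
      ultimately have "avg (Suc k) d' (\<lambda>z. of_bool (\<forall>i<q. E i (inst z t)) * g (inst z t)) \<le> \<epsilon> / 2"
        using d'[rule_format, of d' r "\<lambda>i z. E i (inst z t)" "\<lambda>z. g (inst z t)"] E g by auto
      then show ?thesis unfolding h_def avg_diff by simp
    qed
    then have le: "avg (Suc k) n (\<lambda>z. of_bool (E q z) * h z) \<le> \<epsilon> / 2"
      using N n E h1 by blast
    have "of_bool (\<forall>i<Suc q. E i z) * g z = of_bool (E q z) * h z + \<epsilon> / 2 * of_bool (E q z)" for z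
      by (auto simp: h_def less_Suc_eq)
    then have "avg (Suc k) n (\<lambda>z. of_bool (\<forall>i<Suc q. E i z) * g z)
        = avg (Suc k) n (\<lambda>z. of_bool (E q z) * h z) + \<epsilon> / 2 * avg (Suc k) n (\<lambda>z. of_bool (E q z))"
      by (simp only: avg_add avg_cmult)
    also have "avg (Suc k) n (\<lambda>z. of_bool (E q z)) \<le> 1" by (intro avg_le_const) auto
    finally show ?thesis using le \<epsilon>2 by (simp add: mult_left_mono)
  qed
  then show ?case by blast
qed

subsection \<open>The induction on the alphabet\<close>

lemma avg_not_in: "avg (Suc k) m (\<lambda>z. of_bool (k \<notin> set z)) = (real k / real (Suc k)) ^ m"
proof -
  have "words (Suc k) m \<inter> {z. k \<notin> set z} = words k m"
    using words_Suc_not_in words_mono[of k "Suc k" m] by (auto simp: words_def)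
  then have "(\<Sum>z\<in>words (Suc k) m. of_bool (k \<notin> set z)) = real (k ^ m)"
    by (simp add: card_words)
  then show ?thesis by (simp add: avg_def power_divide)
qed

text \<open>Disjoint decomposition according to the first index that fails.\<close>

lemma of_bool_not_all_eq_sum:
  fixes k :: nat
  shows "of_bool (\<not> (\<forall>i<k. P i)) = (\<Sum>i<k. of_bool ((\<forall>j<i. P j) \<and> \<not> P i) :: real)"
proof (induction k)
  case (Suc k)
  have "of_bool (\<not> (\<forall>i<Suc k. P i))
      = (of_bool (\<not> (\<forall>i<k. P i)) + of_bool ((\<forall>j<k. P j) \<and> \<not> P k) :: real)"
    by (auto simp: less_Suc_eq)
  then show ?case by (simp only: Suc.IH sum.lessThan_Suc)
qed simp

lemma ball_words_1: "(\<forall>z\<in>words k 1. Q z) \<longleftrightarrow> (\<forall>i<k. Q [i])"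
  by (auto simp: singleton_words simp del: One_nat_def)

lemma line_template:
  assumes "w \<in> words (Suc k) n" "k \<in> set w"
  obtains t where "t \<in> template (Suc k) 1 n" "\<And>i. inst [i] t = replace k i w"
proof
  define t :: "(nat + nat) list" where "t = map (\<lambda>a. if a = k then Inr 0 else Inl a) w"
  show "t \<in> template (Suc k) 1 n"
  proof (rule templateI)
    fix s assume "s \<in> set t"
    then show "(\<exists>a<Suc k. s = Inl a) \<or> (\<exists>i<1. s = Inr i)"
      using assms(1) by (auto simp: t_def words_def)
  next
    fix i :: nat assume "i < 1"
    then show "Inr i \<in> set t" using assms(2) by (auto simp: t_def image_iff)
  qed (use assms(1) in \<open>simp add: t_def words_length\<close>)
  show "inst [i] t = replace k i w" for i
    by (simp add: inst_def t_def replace_def)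
qed

lemma dhj_mono:
  assumes "dhj k m \<delta>" "\<delta> \<le> \<delta>'"
  shows "dhj k m \<delta>'"
  using assms unfolding dhj_def by (meson order_trans)

text \<open>If \<open>\<sigma>\<close> were the critical density, a line-free set \<open>A\<close> of density almost \<open>\<sigma>\<close> would have density at
  most slightly above \<open>\<sigma>\<close> on every subspace, hence almost exactly \<open>\<sigma>\<close> on all the subspaces \<open>{x} \<times> \<dots>\<close>.
  By Graham--Rothschild the sets \<open>D i\<close> below all hold at once with density at least \<open>\<theta>\<close>, and as \<open>A\<close>
  essentially misses their intersection it is too dense on the complement, which is a disjoint union of
  intersections of insensitive sets.\<close>

lemma dhj_improve:
  assumes k: "k > 0" and dhj: "\<And>\<delta>. \<delta> > 0 \<Longrightarrow> dhj k 1 \<delta>" and \<sigma>: "\<sigma> > 0"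
    and above: "\<And>\<tau>. \<tau> > 0 \<Longrightarrow> dhj (Suc k) 1 (\<sigma> + \<tau>)"
  shows "\<exists>\<tau>>0. dhj (Suc k) 1 (\<sigma> - \<tau>)"
proof -
  define K where "K = Suc k"
  have K: "K > 0" "k < K" "k \<le> K" by (auto simp: K_def)
  \<comment> \<open>Fibres will have density at least \<open>\<sigma> / 2\<close>, and
    \<open>dhj_common_template\<close> costs another factor 2.\<close>
  obtain \<Lambda> where \<Lambda>: "\<And>n A. \<Lambda> \<le> n \<Longrightarrow> \<sigma> / 2 / 2 \<le> avg k n (\<lambda>w. of_bool (A w)) \<Longrightarrow>
      \<exists>t\<in>template k 1 n. \<forall>z\<in>words k 1. A (inst z t)"
    using dhjE[OF dhj[of "\<sigma> / 2 / 2"]] \<sigma> by auto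
  define \<theta> where "\<theta> = min 1 (\<sigma> / 2 / 2 / (real (card (template k 1 \<Lambda>)) + 1))"
  have \<theta>: "0 < \<theta>" "\<theta> \<le> 1" using \<sigma> by (auto simp: \<theta>_def)
  \<comment> \<open>The gain \<open>\<sigma> * \<theta> / 2\<close> is then
    \<open>8 * \<eta>\<close>. It beats the loss of \<open>3 * \<eta>\<close>, from density
    fluctuation and words without \<open>k\<close>, together with the \<open>2 * \<eta>\<close>
    granted to the \<open>k\<close> insensitive parts through \<open>\<epsilon>\<close>.\<close>
  define \<eta> where "\<eta> = \<sigma> * \<theta> / 16"
  have \<eta>: "0 < \<eta>" "\<eta> \<le> \<sigma> / 2"
  proof -
    show "0 < \<eta>" using \<sigma> \<theta> by (simp add: \<eta>_def)
    have "\<sigma> * \<theta> \<le> \<sigma> * 1" using \<sigma> \<theta> by (intro mult_left_mono) auto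
    then show "\<eta> \<le> \<sigma> / 2" using \<sigma> unfolding \<eta>_def by linarith
  qed
  define \<epsilon> where "\<epsilon> = 2 * \<eta> / real k"
  have \<epsilon>: "\<epsilon> > 0" using \<eta> k by (simp add: \<epsilon>_def)
  obtain d where d: "\<And>n A. d \<le> n \<Longrightarrow> \<sigma> + \<eta> \<le> avg K n (\<lambda>w. of_bool (A w)) \<Longrightarrow>
      \<exists>t\<in>template K 1 n. \<forall>z\<in>words K 1. A (inst z t)"
    using dhjE[OF above[OF \<eta>(1)]] unfolding K_def by auto
  obtain N where N: "\<forall>n\<ge>N. \<forall>r E g. (\<forall>i<k. r i < k \<and> insensitive k (r i) n (E i)) \<longrightarrow> (\<forall>z. g z \<le> 1) \<longrightarrow>
    (\<forall>t\<in>template (Suc k) d n. avg (Suc k) d (\<lambda>z. g (inst z t)) \<le> 0) \<longrightarrow>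
    avg (Suc k) n (\<lambda>z. of_bool (\<forall>i<k. E i z) * g z) \<le> \<epsilon>"
    by (rule exE[OF insensitive_intersection_sum_le[OF k dhj_multidim[OF k dhj] \<epsilon>]])
  obtain m where m: "N \<le> m" "\<Lambda> \<le> m" "(real k / real K) ^ m < min (1 / 2) \<eta>"
  proof -
    have "(\<lambda>m. (real k / real K) ^ m) \<longlonglongrightarrow> 0"
      by (rule LIMSEQ_power_zero) (simp add: K_def)
    then have "eventually (\<lambda>m. (real k / real K) ^ m < min (1 / 2) \<eta>) sequentially"
      by (rule order_tendstoD(2)) (use \<eta> in simp)
    then have "eventually (\<lambda>m. N \<le> m \<and> \<Lambda> \<le> m \<and> (real k / real K) ^ m < min (1 / 2) \<eta>) sequentially"
      by (intro eventually_conj eventually_ge_at_top)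
    then show ?thesis using that by (auto simp: eventually_sequentially)
  qed
  define \<xi> where "\<xi> = (real k / real K) ^ m"
  have \<xi>: "\<xi> \<le> 1 / 2" "\<xi> \<le> \<eta>" using m(3) by (auto simp: \<xi>_def)
  obtain l where l: "\<forall>P :: nat list \<Rightarrow> bool. \<exists>e\<in>template k m l.
     (\<forall>z\<in>words (Suc k) m. k \<in> set z \<longrightarrow> P (inst z e)) \<or>
     (\<forall>z\<in>words (Suc k) m. k \<in> set z \<longrightarrow> \<not> P (inst z e))"
    by (rule exE[OF graham_rothschild_line[OF k]])
  define \<tau> where "\<tau> = \<eta> / (2 * real K ^ l)"
  have \<tau>: "\<tau> > 0" using \<eta> K by (simp add: \<tau>_def)
  obtain M where M: "\<And>n A. M \<le> n \<Longrightarrow> \<sigma> + \<tau> \<le> avg K n (\<lambda>w. of_bool (A w)) \<Longrightarrow>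
      \<exists>t\<in>template K 1 n. \<forall>z\<in>words K 1. A (inst z t)"
    using dhjE[OF above[OF \<tau>(1)]] unfolding K_def by auto
  have "\<exists>t\<in>template K 1 n. \<forall>z\<in>words K 1. A (inst z t)"
    if n: "M + l \<le> n" and A: "\<sigma> - \<tau> \<le> avg K n (\<lambda>w. of_bool (A w))" for n A
  proof (rule ccontr)
    assume free: "\<not> ?thesis"
    define n' where "n' = n - l"
    have n': "n = l + n'" "M \<le> n'" using n by (auto simp: n'_def)
    have dens_le: "avg K n' (\<lambda>y. of_bool (A (x @ y))) \<le> \<sigma> + \<tau>" if x: "x \<in> words K l" for x
    proof (rule ccontr)
      assume "\<not> ?thesis"
      then obtain t where t: "t \<in> template K 1 n'" "\<forall>z\<in>words K 1. A (x @ inst z t)"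
        using M[OF n'(2), of "\<lambda>y. A (x @ y)"] by force
      then show False
        using free Inl_append_template[OF x t(1)] by (force simp: n'(1) inst_append)
    qed
    \<comment> \<open>The deficits against \<open>\<sigma> + \<tau>\<close> are nonnegative and
      average at most \<open>2 * \<tau>\<close>. By the choice of \<open>\<tau>\<close> even their
      total over all \<open>K ^ l\<close> fibres is at most \<open>\<eta>\<close>, so each one
      is.\<close>
    have dens_ge: "\<sigma> - \<eta> \<le> avg K n' (\<lambda>y. of_bool (A (x @ y)))" if x: "x \<in> words K l" for x
    proof -
      define h where "h x = \<sigma> + \<tau> - avg K n' (\<lambda>y. of_bool (A (x @ y)))" for x
      have "avg K l h = \<sigma> + \<tau> - avg K n (\<lambda>w. of_bool (A w))"
        unfolding h_def avg_diff n'(1) avg_append by (simp add: K)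
      then have "avg K l h \<le> 2 * \<tau>" using A by simp
      then have "(\<Sum>x\<in>words K l. h x) \<le> \<eta>"
        using K by (simp add: avg_def \<tau>_def divide_le_eq)
      moreover have "h x \<le> (\<Sum>x\<in>words K l. h x)"
        using dens_le by (intro member_le_sum[OF x]) (auto simp: h_def)
      ultimately show ?thesis using \<tau> by (simp add: h_def)
    qed
    define P where "P v \<longleftrightarrow> \<theta> \<le> avg K n' (\<lambda>y. of_bool (\<forall>i<k. A (replace k i v @ y)))" for v
    obtain e where e: "e \<in> template k m l" and
      mono: "(\<forall>z\<in>words K m. k \<in> set z \<longrightarrow> P (inst z e)) \<or> (\<forall>z\<in>words K m. k \<in> set z \<longrightarrow> \<not> P (inst z e))"
      using l[rule_format, of P] unfolding K_def by blast
    have e': "e \<in> template K m l" using e template_mono[OF K(3)] by blast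
    have replace_e: "replace k i (inst z e) = inst (replace k i z) e" if "z \<in> words K m" for i z
      using inst_replace[OF e words_length[OF that]] by simp
    \<comment> \<open>This rules out the negative alternative of Graham--Rothschild: the theorem
      over \<open>k\<close> letters, applied to the first \<open>\<Lambda>\<close> variables with
      the others set to 0, gives one variable word with \<open>P\<close>.\<close>
    have "\<exists>z\<in>words K m. k \<in> set z \<and> P (inst z e)"
    proof -
      define zs where "zs = replicate (m - \<Lambda>) (0::nat)"
      have zs: "zs \<in> words j (m - \<Lambda>)" if "j > 0" for j
        unfolding zs_def by (rule replicate_words[OF that])
      have pad: "w @ zs \<in> words j m" if "w \<in> words j \<Lambda>" "j > 0" for w j
        using append_words[OF that(1) zs[OF that(2)]] m(2) by simp
      have "\<sigma> / 2 \<le> avg k \<Lambda> (\<lambda>w. avg K n' (\<lambda>y. of_bool (A (inst (w @ zs) e @ y))))"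
      proof (rule avg_ge_const[OF k])
        fix w assume w: "w \<in> words k \<Lambda>"
        have "inst (w @ zs) e \<in> words K l"
          using inst_words_le[OF e _ pad[OF w k]] words_mono[OF K(3)] by auto
        from dens_ge[OF this] show "\<sigma> / 2 \<le> avg K n' (\<lambda>y. of_bool (A (inst (w @ zs) e @ y)))"
          using \<eta>(2) by simp
      qed
      then have "\<sigma> / 2 \<le> avg K n' (\<lambda>y. avg k \<Lambda> (\<lambda>w. of_bool (A (inst (w @ zs) e @ y))))"
        by (subst avg_swap)
      then obtain t where t: "t \<in> template k 1 \<Lambda>" "\<sigma> / 2 / 2 / real (card (template k 1 \<Lambda>))
          \<le> avg K n' (\<lambda>y. of_bool (\<forall>z\<in>words k 1. A (inst (inst z t @ zs) e @ y)))"
        using dhj_common_template[OF k K(1) half_gt_zero[OF \<sigma>], of \<Lambda> 1 n'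
            "\<lambda>w y. A (inst (w @ zs) e @ y)"] \<Lambda> by blast
      have kw: "[k] \<in> words K 1" by (simp add: singleton_words K)
      define z where "z = inst [k] t @ zs"
      have z: "z \<in> words K m" unfolding z_def by (rule pad[OF inst_words_le[OF t(1) K(3) kw] K(1)])
      have "k \<in> set (inst [k] t)" by (rule letter_in_inst[OF t(1) kw]) simp
      then have kz: "k \<in> set z" by (simp add: z_def)
      have replace_z: "replace k i z = inst [i] t @ zs" for i
        using inst_replace[OF t(1), of "[k]" i] k by (simp add: z_def replace_append) (simp add: replace_def zs_def)
      have "card (template k 1 \<Lambda>) > 0"
        using t(1) finite_template by (auto simp: card_gt_0_iff)
      then have "\<theta> \<le> \<sigma> / 2 / 2 / real (card (template k 1 \<Lambda>))"
        unfolding \<theta>_def using \<sigma> by (intro min.coboundedI2 divide_left_mono) auto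
      also have "\<dots> \<le> avg K n' (\<lambda>y. of_bool (\<forall>i<k. A (replace k i (inst z e) @ y)))"
        using t(2) unfolding replace_e[OF z] replace_z ball_words_1 .
      finally show ?thesis using z kz unfolding P_def by blast
    qed
    then have good: "\<theta> \<le> avg K n' (\<lambda>y. of_bool (\<forall>i<k. A (inst (replace k i z) e @ y)))"
      if "z \<in> words K m" "k \<in> set z" for z
      using mono that replace_e[OF that(1)] unfolding P_def by auto
    define a where "a y z \<longleftrightarrow> A (inst z e @ y)" for y z
    define D where "D y i z \<longleftrightarrow> A (inst (replace k i z) e @ y)" for y i z
    have a_ge: "\<sigma> - \<eta> \<le> avg K n' (\<lambda>y. avg K m (\<lambda>z. of_bool (a y z)))"
      unfolding a_def by (subst avg_swap) (intro avg_ge_const[OF K(1)] dens_ge inst_words[OF e'])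
    have D_ge: "\<theta> / 2 \<le> avg K n' (\<lambda>y. avg K m (\<lambda>z. of_bool (\<forall>i<k. D y i z)))"
    proof -
      have not_in: "avg K m (\<lambda>z. of_bool (k \<notin> set z)) = \<xi>"
        unfolding K_def \<xi>_def by (rule avg_not_in)
      have "\<theta> * (1 - 1 / 2) \<le> \<theta> * (1 - \<xi>)" using \<xi> \<theta> by (intro mult_left_mono) auto
      also have "\<dots> = avg K m (\<lambda>z. \<theta> * (1 - of_bool (k \<notin> set z)))"
        by (simp only: avg_cmult avg_diff not_in avg_const[OF K(1)])
      also have "\<dots> \<le> avg K m (\<lambda>z. avg K n' (\<lambda>y. of_bool (\<forall>i<k. D y i z)))"
      proof (rule avg_mono)
        fix z assume z: "z \<in> words K m"
        show "\<theta> * (1 - of_bool (k \<notin> set z)) \<le> avg K n' (\<lambda>y. of_bool (\<forall>i<k. D y i z))"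
          using good[OF z] avg_ge_const[OF K(1), of n' 0 "\<lambda>y. of_bool (\<forall>i<k. D y i z)"]
          unfolding D_def by (cases "k \<in> set z") auto
      qed
      also have "\<dots> = avg K n' (\<lambda>y. avg K m (\<lambda>z. of_bool (\<forall>i<k. D y i z)))" by (rule avg_swap)
      finally show ?thesis by simp
    qed
    \<comment> \<open>Otherwise the point and its replacements would form a full line in
      \<open>A\<close>.\<close>
    have aD: "k \<notin> set z"
      if "a y z" "\<forall>i<k. D y i z" and z: "z \<in> words K m" and y: "y \<in> words K n'" for y z
    proof
      assume kz: "k \<in> set z"
      have "inst z e \<in> words (Suc k) l" using inst_words[OF e' z] unfolding K_def .
      then obtain t where t: "t \<in> template (Suc k) 1 l" "\<And>i. inst [i] t = replace k i (inst z e)"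
        using line_template[of "inst z e" k l thesis] letter_in_inst[OF e z kz] by blast
      have "A (inst [i] t @ y)" if "i < K" for i
      proof (cases "i = k")
        case True
        have "replace k k (inst z e) = inst z e" by (simp add: replace_def map_idI)
        then show ?thesis using \<open>a y z\<close> True by (simp add: t a_def)
      next
        case False
        then show ?thesis
          using \<open>\<forall>i<k. D y i z\<close> that by (simp add: t replace_e[OF z] D_def K_def)
      qed
      then have "\<forall>w\<in>words K 1. A (inst w (t @ map Inl y))"
        by (auto simp: singleton_words inst_append simp del: One_nat_def)
      then show False
        using free append_Inl_template[OF y] t(1) unfolding K_def n'(1) by blast
    qed
    define g where "g y z = of_bool (a y z) - (\<sigma> + \<eta>)" for y z
    have "4 * \<eta> \<le> avg K n' (\<lambda>y. avg K m (\<lambda>z. of_bool (\<not> (\<forall>i<k. D y i z)) * g y z))"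
    proof -
      have "4 * \<eta> \<le> (\<sigma> - \<eta>) - \<xi> - (\<sigma> + \<eta>) + \<sigma> * (\<theta> / 2)"
        using \<xi>(2) \<eta>(1) unfolding \<eta>_def by linarith
      also have "\<sigma> * (\<theta> / 2) \<le> (\<sigma> + \<eta>) * avg K n' (\<lambda>y. avg K m (\<lambda>z. of_bool (\<forall>i<k. D y i z)))"
        using D_ge \<sigma> \<eta> \<theta> by (intro mult_mono) auto
      also have "\<sigma> - \<eta> \<le> avg K n' (\<lambda>y. avg K m (\<lambda>z. of_bool (a y z)))" by (rule a_ge)
      also have "avg K n' (\<lambda>y. avg K m (\<lambda>z. of_bool (a y z))) - \<xi> - (\<sigma> + \<eta>)
            + (\<sigma> + \<eta>) * avg K n' (\<lambda>y. avg K m (\<lambda>z. of_bool (\<forall>i<k. D y i z)))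
          = avg K n' (\<lambda>y. avg K m (\<lambda>z. of_bool (a y z) - of_bool (k \<notin> set z) - (\<sigma> + \<eta>)
              + (\<sigma> + \<eta>) * of_bool (\<forall>i<k. D y i z)))"
        by (simp only: avg_add avg_diff avg_cmult avg_const[OF K(1)] avg_not_in[of k m, folded K_def] \<xi>_def)
      \<comment> \<open>Pointwise: where all \<open>D y i z\<close> hold, \<open>a y z\<close>
        forces \<open>k\<close> to be absent from \<open>z\<close>; elsewhere a nonnegative term is
        dropped.\<close>
      also have "\<dots> \<le> avg K n' (\<lambda>y. avg K m (\<lambda>z. of_bool (\<not> (\<forall>i<k. D y i z)) * g y z))"
        using aD by (intro avg_mono) (auto simp: g_def)
      finally show ?thesis by simp
    qed
    then obtain y where y: "y \<in> words K n'"
      "4 * \<eta> \<le> avg K m (\<lambda>z. of_bool (\<not> (\<forall>i<k. D y i z)) * g y z)"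
      by (rule avg_exists_ge[OF K(1)])
    have part: "avg K m (\<lambda>z. of_bool ((\<forall>j<i. D y j z) \<and> \<not> D y i z) * g y z) \<le> \<epsilon>" if i: "i < k" for i
    proof -
      \<comment> \<open>For \<open>j > i\<close> the set is everything, so each part is an
        intersection of exactly \<open>k\<close> insensitive sets.\<close>
      define E where "E j z \<longleftrightarrow> (if j < i then D y j z else j = i \<longrightarrow> \<not> D y i z)" for j z
      have "(\<forall>j<k. E j z) \<longleftrightarrow> (\<forall>j<i. D y j z) \<and> \<not> D y i z" for z
        using i by (auto simp: E_def)
      moreover have "insensitive k j m (E j)" for j
        by (simp add: insensitive_def E_def D_def replace_replace)
      moreover have "g y z \<le> 1" for z using \<sigma> \<eta> by (simp add: g_def)
      moreover have "avg K d (\<lambda>z. g y (inst z t)) \<le> 0" if t: "t \<in> template K d m" for t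
      proof (rule ccontr)
        assume "\<not> ?thesis"
        then have "\<sigma> + \<eta> \<le> avg K d (\<lambda>z. of_bool (a y (inst z t)))"
          unfolding g_def avg_diff by (simp add: K)
        then obtain u where u: "u \<in> template K 1 d" "\<forall>z\<in>words K 1. A (inst (inst (inst z u) t) e @ y)"
          using d[of d "\<lambda>z. a y (inst z t)"] unfolding a_def by auto
        have ut: "compose u t \<in> template K 1 m" by (rule compose_template[OF u(1) t])
        have "\<forall>z\<in>words K 1. A (inst z (compose (compose u t) e @ map Inl y))"
          using u(2) inst_compose[OF e' template_length[OF ut]] inst_compose[OF t template_length[OF u(1)]]
          by (simp add: inst_append)
        then show False
          using free append_Inl_template[OF y(1) compose_template[OF ut e']] unfolding n'(1) by blast
      qed
      ultimately show ?thesis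
        using N[rule_format, of m "\<lambda>j. j" E "g y"] m(1) unfolding K_def by simp
    qed
    have "avg K m (\<lambda>z. of_bool (\<not> (\<forall>i<k. D y i z)) * g y z)
        = (\<Sum>i<k. avg K m (\<lambda>z. of_bool ((\<forall>j<i. D y j z) \<and> \<not> D y i z) * g y z))"
      unfolding of_bool_not_all_eq_sum sum_distrib_right avg_sum ..
    also have "\<dots> \<le> (\<Sum>i<k. \<epsilon>)" by (intro sum_mono part) simp
    also have "\<dots> = 2 * \<eta>" using k by (simp add: \<epsilon>_def)
    finally show False using y(2) \<eta>(1) by simp
  qed
  then have "dhj K 1 (\<sigma> - \<tau>)" unfolding dhj_def by blast
  then show ?thesis using \<tau> unfolding K_def by blast
qed

text \<open>\<open>Inf S\<close> is the critical density. If it were positive,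
  \<open>dhj_improve\<close> would produce an admissible density below it.\<close>

lemma dhj_Suc:
  assumes k: "k > 0" and dhj: "\<And>\<delta>. \<delta> > 0 \<Longrightarrow> dhj k 1 \<delta>" and \<delta>: "\<delta> > 0"
  shows "dhj (Suc k) 1 \<delta>"
proof -
  define S where "S = {\<delta>. \<delta> > 0 \<and> dhj (Suc k) 1 \<delta>}"
  have "dhj (Suc k) 1 2"
  proof -
    have le: "avg (Suc k) n (\<lambda>w. of_bool (A w)) \<le> 1" for n A
      by (intro avg_le_const) auto
    have "\<not> 2 \<le> avg (Suc k) n (\<lambda>w. of_bool (A w))" for n A
      using le[of n A] by linarith
    then show ?thesis unfolding dhj_def by blast
  qed
  then have S: "S \<noteq> {}" "bdd_below S"
    by (auto simp: S_def intro!: bdd_belowI[of _ 0] exI[of _ 2])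
  have above: "dhj (Suc k) 1 x" if "Inf S < x" for x
  proof -
    obtain s where "s \<in> S" "s < x" using cInf_lessD[OF S(1) \<open>Inf S < x\<close>] by blast
    then show ?thesis using dhj_mono[of "Suc k" 1 s x] by (simp add: S_def)
  qed
  have "Inf S \<le> 0"
  proof (rule ccontr)
    assume "\<not> Inf S \<le> 0"
    then have pos: "Inf S > 0" by simp
    have step: "dhj (Suc k) 1 (Inf S + \<tau>)" if "\<tau> > 0" for \<tau>
      using that by (intro above) simp
    obtain \<tau> where "\<tau> > 0 \<and> dhj (Suc k) 1 (Inf S - \<tau>)"
      by (rule exE[OF dhj_improve[OF k dhj pos step]])
    then have \<tau>: "\<tau> > 0" "dhj (Suc k) 1 (Inf S - \<tau>)" by auto
    \<comment> \<open>\<open>Inf S - \<tau>\<close> may be negative, whereas members of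
      \<open>S\<close> are positive.\<close>
    define x where "x = max (Inf S - \<tau>) (Inf S / 2)"
    have "x \<in> S" using pos dhj_mono[OF \<tau>(2), of x] by (auto simp: S_def x_def)
    then have "Inf S \<le> x" using S(2) by (rule cInf_lower)
    then show False using pos \<tau>(1) by (auto simp: x_def max_def split: if_splits)
  qed
  then show ?thesis using above \<delta> by simp
qed

theorem density_hales_jewett:
  assumes "k > 0" "\<delta> > 0"
  shows "dhj k 1 \<delta>"
proof -
  have "\<forall>\<delta>>0. dhj (Suc j) 1 \<delta>" for j
  proof (induction j)
    case 0
    have "\<exists>t\<in>template 1 1 n. \<forall>z\<in>words 1 1. A (inst z t)"
      if n: "1 \<le> n" and A: "\<delta> \<le> avg 1 n (\<lambda>w. of_bool (A w))" and \<delta>: "\<delta> > 0" for n A and \<delta> :: real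
    proof -
      obtain w where w: "w \<in> words 1 n" "\<delta> \<le> of_bool (A w)"
        using avg_exists_ge[OF zero_less_one A] by blast
      have "w = replicate n 0" using w(1) by (auto simp: words_def intro!: replicate_eqI)
      then have "A (replicate n 0)" using w(2) \<delta> by (auto split: if_splits simp: of_bool_def)
      moreover have "inst z (replicate n (Inr 0)) = replicate n 0" if "z \<in> words 1 1" for z
        using that by (auto simp: singleton_words inst_def simp del: One_nat_def)
      moreover have "replicate n (Inr 0) \<in> template 1 1 n"
        using n by (intro templateI) auto
      ultimately show ?thesis by metis
    qed
    then show ?case unfolding dhj_def One_nat_def[symmetric] by blast
  next
    case (Suc j)
    then show ?case using dhj_Suc[of "Suc j"] by simp
  qed
  then show ?thesis using assms by (cases k) auto
qed

section \<open>Arithmetic progressions with step in an IP set\<close>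

text \<open>Along a line the variable positions \<open>S\<close> change together, so the weighted
  sum of the letters runs through an arithmetic progression whose step is the sum of
  \<open>x\<close> over \<open>S\<close>.\<close>

lemma ip_szemeredi:
  fixes A :: "int set" and x :: "nat \<Rightarrow> nat"
  assumes \<delta>: "\<delta> > 0"
    and dense: "\<forall>N0. \<exists>N\<ge>N0. \<exists>M. \<delta> * real N \<le> real (card (A \<inter> {M + 1..M + int N}))"
  obtains S a where "finite S" "S \<noteq> {}" "\<And>i. i \<le> l \<Longrightarrow> a + int i * int (\<Sum>j\<in>S. x j) \<in> A"
proof -
  define K where "K = Suc l"
  have K: "K > 0" by (simp add: K_def)
  obtain n where n: "\<And>m P. n \<le> m \<Longrightarrow> \<delta> / 2 \<le> avg K m (\<lambda>w. of_bool (P w)) \<Longrightarrow>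
      \<exists>t\<in>template K 1 m. \<forall>z\<in>words K 1. P (inst z t)"
    using dhjE[OF density_hales_jewett[OF K half_gt_zero[OF \<delta>]]] by auto
  define \<sigma> where "\<sigma> w = (\<Sum>j<n. w ! j * x j)" for w
  define B where "B = (\<Sum>j<n. l * x j)"
  have \<sigma>: "\<sigma> w \<le> B" if "w \<in> words K n" for w
    unfolding \<sigma>_def B_def using words_nth[OF that]
    by (intro sum_mono mult_right_mono) (auto simp: K_def less_Suc_eq_le)
  \<comment> \<open>With \<open>N > B\<close>, extending the interval by the largest shift at most
    doubles it; this is the factor 2 lost in \<open>\<delta> / 2\<close>.\<close>
  obtain N M where N: "N \<ge> Suc B" "\<delta> * real N \<le> real (card (A \<inter> {M + 1..M + int N}))"
    using dense by blast
  define J where "J = {M + 1 - int B..M + int N}"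
  have J: "finite J" "J \<noteq> {}" "real (card J) \<le> 2 * real N" using N(1) by (auto simp: J_def)
  have "real (card (A \<inter> {M + 1..M + int N})) \<le> (\<Sum>a\<in>J. of_bool (a + int (\<sigma> w) \<in> A))"
    if w: "w \<in> words K n" for w
  proof -
    have "(\<lambda>v. v - int (\<sigma> w)) ` (A \<inter> {M + 1..M + int N}) \<subseteq> J \<inter> {a. a + int (\<sigma> w) \<in> A}"
      using \<sigma>[OF w] by (auto simp: J_def)
    then have "card ((\<lambda>v. v - int (\<sigma> w)) ` (A \<inter> {M + 1..M + int N}))
        \<le> card (J \<inter> {a. a + int (\<sigma> w) \<in> A})"
      by (intro card_mono finite_Int) (auto simp: J(1))
    moreover have "inj_on (\<lambda>v. v - int (\<sigma> w)) (A \<inter> {M + 1..M + int N})"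
      by (auto simp: inj_on_def)
    ultimately show ?thesis
      using J(1) by (simp add: card_image)
  qed
  then have "\<delta> * real N \<le> avg K n (\<lambda>w. \<Sum>a\<in>J. of_bool (a + int (\<sigma> w) \<in> A))"
    using N(2) by (intro avg_ge_const[OF K]) fastforce
  also have "\<dots> = (\<Sum>a\<in>J. avg K n (\<lambda>w. of_bool (a + int (\<sigma> w) \<in> A)))"
    by (rule avg_sum)
  finally have ge: "\<delta> * real N \<le> (\<Sum>a\<in>J. avg K n (\<lambda>w. of_bool (a + int (\<sigma> w) \<in> A)))" .
  obtain a where a: "\<delta> / 2 \<le> avg K n (\<lambda>w. of_bool (a + int (\<sigma> w) \<in> A))"
  proof (rule ccontr)
    assume "\<not> thesis"
    then have "avg K n (\<lambda>w. of_bool (a + int (\<sigma> w) \<in> A)) < \<delta> / 2" for a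
      using that by (meson not_le)
    then have "(\<Sum>a\<in>J. avg K n (\<lambda>w. of_bool (a + int (\<sigma> w) \<in> A))) < (\<Sum>a\<in>J. \<delta> / 2)"
      using J by (intro sum_strict_mono) auto
    also have "\<dots> \<le> 2 * real N * (\<delta> / 2)"
      using J(3) \<delta> by (simp add: mult_right_mono)
    finally show False using ge by (simp add: mult.commute)
  qed
  obtain t where t: "t \<in> template K 1 n" "\<forall>z\<in>words K 1. a + int (\<sigma> (inst z t)) \<in> A"
    using n[OF order_refl, of "\<lambda>w. a + int (\<sigma> w) \<in> A"] a by blast
  define S where "S = {j\<in>{..<n}. t ! j = Inr 0}"
  define C where "C = (\<Sum>j\<in>{..<n} - S. (case t ! j of Inl c \<Rightarrow> c | Inr _ \<Rightarrow> 0) * x j)"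
  have \<sigma>_line: "\<sigma> (inst [i] t) = C + i * (\<Sum>j\<in>S. x j)" for i
  proof -
    have len: "length t = n" by (rule template_length[OF t(1)])
    have fixed: "\<exists>c. t ! j = Inl c" if "j \<in> {..<n} - S" for j
      using template_elem[OF t(1), of "t ! j"] that len by (auto simp: S_def)
    have "\<sigma> (inst [i] t) = (\<Sum>j\<in>{..<n} - S. inst [i] t ! j * x j) + (\<Sum>j\<in>S. inst [i] t ! j * x j)"
      unfolding \<sigma>_def by (intro sum.subset_diff) (auto simp: S_def)
    also have "(\<Sum>j\<in>{..<n} - S. inst [i] t ! j * x j) = C"
      unfolding C_def by (intro sum.cong refl) (use fixed len in \<open>fastforce simp: inst_def\<close>)
    also have "(\<Sum>j\<in>S. inst [i] t ! j * x j) = (\<Sum>j\<in>S. i * x j)"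
      by (intro sum.cong refl) (use len in \<open>auto simp: S_def inst_def\<close>)
    finally show ?thesis by (simp add: sum_distrib_left)
  qed
  show ?thesis
  proof
    show "finite S" by (simp add: S_def)
    obtain j where "j < length t" "t ! j = Inr 0"
      using template_var[OF t(1), of 0] by (auto simp: in_set_conv_nth)
    then show "S \<noteq> {}" using template_length[OF t(1)] by (auto simp: S_def)
    show "(a + int C) + int i * int (\<Sum>j\<in>S. x j) \<in> A" if "i \<le> l" for i
    proof -
      have "[i] \<in> words K 1" using that by (simp add: singleton_words K_def)
      then have "a + int (\<sigma> (inst [i] t)) \<in> A" using t(2) by blast
      then show ?thesis unfolding \<sigma>_line by (simp add: algebra_simps)
    qed
  qed
qed

section \<open>Banach densities\<close>

lemma fekete:
  fixes f :: "nat \<Rightarrow> real"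
  assumes nonneg: "\<And>n. 0 \<le> f n" and sub: "\<And>m n. f (m + n) \<le> f m + f n"
  shows "convergent (\<lambda>n. f n / real n)"
proof -
  define L where "L = (INF n\<in>{1..}. f n / real n)"
  have bdd: "bdd_below ((\<lambda>n. f n / real n) ` {1..})"
    by (rule bdd_belowI[of _ 0]) (auto simp: nonneg)
  have L_le: "L \<le> f n / real n" if "n \<ge> 1" for n
    unfolding L_def using that by (intro cINF_lower[OF bdd]) auto
  have mult: "f (q * m + r) \<le> real q * f m + f r" for q m r
  proof (induction q)
    case (Suc q)
    have "f (Suc q * m + r) \<le> f m + f (q * m + r)"
      using sub[of m "q * m + r"] by (simp add: add.assoc)
    then show ?case using Suc by (simp add: algebra_simps)
  qed simp
  have "(\<lambda>n. f n / real n) \<longlonglongrightarrow> L"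
  proof (rule order_tendstoI)
    fix a assume "a < L"
    then show "eventually (\<lambda>n. a < f n / real n) sequentially"
      using L_le by (intro eventually_sequentiallyI[of 1]) force
  next
    fix a assume a: "L < a"
    obtain m where m: "m \<ge> 1" "f m / real m < a"
      using a cINF_less_iff[OF _ bdd] unfolding L_def by auto
    define C where "C = (\<Sum>r<m. f r)"
    have C: "f r \<le> C" if "r < m" for r
      unfolding C_def using that nonneg by (intro member_le_sum) auto
    have "(\<lambda>n. f m / real m + C / real n) \<longlonglongrightarrow> f m / real m + 0"
      by (intro tendsto_add tendsto_const lim_const_over_n)
    then have "eventually (\<lambda>n. f m / real m + C / real n < a) sequentially"
      by (rule order_tendstoD(2)) (use m in simp)
    then show "eventually (\<lambda>n. f n / real n < a) sequentially"
      using eventually_gt_at_top[of 0]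
    proof eventually_elim
      case (elim n)
      have "f n \<le> real (n div m) * f m + f (n mod m)"
        using mult[of "n div m" m "n mod m"] by simp
      also have "f (n mod m) \<le> C" using m(1) by (intro C) simp
      also have "real (n div m) * f m \<le> real n / real m * f m"
        using nonneg of_nat_div_le_of_nat[of n m] by (intro mult_right_mono) auto
      finally have "f n / real n \<le> (real n / real m * f m + C) / real n"
        by (intro divide_right_mono) auto
      also have "\<dots> = f m / real m + C / real n"
        using elim(2) by (simp add: add_divide_distrib)
      finally show ?case using elim(1) by simp
    qed
  qed
  then show ?thesis by (rule convergentI)
qed

text \<open>The value of \<open>lim\<close> says something only once convergence is known, which
  comes from subadditivity of the largest count \<open>N * u N\<close>.\<close>

lemma upper_Banach_density_posD:
  assumes "upper_Banach_density A > 0"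
  shows "\<exists>\<delta>>0. \<forall>N0. \<exists>N\<ge>N0. \<exists>M. \<delta> * real N \<le> real (card (A \<inter> {M + 1..M + int N}))"
proof -
  define c where "c M N = real (card (A \<inter> {M + 1..M + int N}))" for M N
  define u where "u N = (SUP M. c M N / real N)" for N
  have c_le: "c M N \<le> real N" for M N
    using card_mono[of "{M + 1..M + int N}" "A \<inter> {M + 1..M + int N}"] by (simp add: c_def)
  have bdd: "bdd_above (range (\<lambda>M. c M N / real N))" for N
    using c_le by (intro bdd_aboveI[of _ 1]) (auto simp: divide_le_eq_1)
  have c_u: "c M N \<le> real N * u N" for M N
  proof (cases "N = 0")
    case False
    have "c M N / real N \<le> u N" unfolding u_def by (rule cSUP_upper[OF UNIV_I bdd])
    then show ?thesis using False by (simp add: divide_le_eq mult.commute)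
  qed (simp add: c_def)
  have c0: "0 \<le> c M N" for M N by (simp add: c_def)
  have "convergent (\<lambda>N. real N * u N / real N)"
  proof (rule fekete)
    show "0 \<le> real N * u N" for N using c0[of 0 N] c_u[of 0 N] by linarith
    show "real (m + n) * u (m + n) \<le> real m * u m + real n * u n" for m n
    proof (cases "m + n = 0")
      case False
      have "c M (m + n) \<le> c M m + c (M + int m) n" for M
      proof -
        have "A \<inter> {M + 1..M + int (m + n)}
            = (A \<inter> {M + 1..M + int m}) \<union> (A \<inter> {M + int m + 1..M + int m + int n})"
          by auto
        then show ?thesis unfolding c_def of_nat_add[symmetric] of_nat_le_iff
          using card_Un_le by metis
      qed
      then have "c M (m + n) \<le> real m * u m + real n * u n" for M
        using c_u[of M m] c_u[of "M + int m" n] by (smt (verit))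
      then have "c M (m + n) / real (m + n) \<le> (real m * u m + real n * u n) / real (m + n)" for M
        by (intro divide_right_mono) auto
      then have "u (m + n) \<le> (real m * u m + real n * u n) / real (m + n)"
        unfolding u_def[of "m + n"] by (intro cSUP_least) auto
      then show ?thesis using False by (simp add: le_divide_eq mult.commute)
    qed simp
  qed
  \<comment> \<open>At \<open>N = 0\<close> both sides are 0 by the convention for division by
    zero.\<close>
  moreover have "u 0 = 0" by (simp add: u_def)
  then have "real N * u N / real N = u N" for N by (cases "N = 0") auto
  then have "(\<lambda>N. real N * u N / real N) = u" by (rule ext)
  ultimately have "u \<longlonglongrightarrow> lim u" by (simp add: convergent_LIMSEQ_iff)
  moreover have "lim u = upper_Banach_density A"
    unfolding upper_Banach_density_def u_def c_def ..
  ultimately have lim: "u \<longlonglongrightarrow> upper_Banach_density A" by simp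
  define \<delta> where "\<delta> = upper_Banach_density A / 2"
  have \<delta>: "\<delta> > 0" "\<delta> < upper_Banach_density A" using assms by (auto simp: \<delta>_def)
  have "\<exists>N\<ge>N0. \<exists>M. \<delta> * real N \<le> c M N" for N0
  proof -
    have "eventually (\<lambda>N. \<delta> < u N \<and> max N0 1 \<le> N) sequentially"
      using order_tendstoD(1)[OF lim \<delta>(2)] eventually_ge_at_top by (rule eventually_conj)
    then obtain N where N: "\<delta> < u N" "N0 \<le> N" "1 \<le> N"
      by (auto simp: eventually_sequentially)
    then obtain M where "\<delta> < c M N / real N"
      using less_cSUP_iff[OF UNIV_not_empty bdd] unfolding u_def by auto
    then have "\<delta> * real N \<le> c M N" using N(3) by (simp add: less_divide_eq)
    then show ?thesis using N(2) by blast
  qed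
  then show ?thesis using \<delta>(1) unfolding c_def by blast
qed

text \<open>Gaps of length at most \<open>g\<close> give density at least
  \<open>1 / (2 * g)\<close>. For convergence, the superadditive minimal count is replaced by
  \<open>N - N * v N\<close>, the largest count of the complement, which is subadditive and
  nonnegative.\<close>

lemma lower_Banach_density_pos:
  assumes g: "\<And>M. \<exists>n\<in>B. M < n \<and> n \<le> M + g"
  shows "lower_Banach_density B > 0"
proof -
  define c where "c M N = real (card (B \<inter> {M + 1..M + N}))" for M N
  define v where "v N = (INF M. c M N / real N)" for N
  have gap: "g > 0" using g[of 0] by auto
  have c_le: "c M N \<le> real N" for M N
    using card_mono[of "{M + 1..M + N}" "B \<inter> {M + 1..M + N}"] by (simp add: c_def)
  have c0: "0 \<le> c M N" for M N by (simp add: c_def)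
  have bdd: "bdd_below (range (\<lambda>M. c M N / real N))" for N
    using c0 by (intro bdd_belowI[of _ 0]) auto
  have c_add: "c M (m + n) = c M m + c (M + m) n" for M m n
  proof -
    have "B \<inter> {M + 1..M + (m + n)} = (B \<inter> {M + 1..M + m}) \<union> (B \<inter> {M + m + 1..M + m + n})"
      by auto
    then show ?thesis by (simp add: c_def card_Un_disjoint disjoint_iff)
  qed
  have v_c: "real N * v N \<le> c M N" for M N
  proof (cases "N = 0")
    case False
    have "v N \<le> c M N / real N" unfolding v_def by (rule cINF_lower[OF bdd UNIV_I])
    then show ?thesis using False by (simp add: le_divide_eq mult.commute)
  qed (simp add: c_def)
  have "convergent (\<lambda>N. (real N - real N * v N) / real N)"
  proof (rule fekete)
    show "0 \<le> real N - real N * v N" for N using c_le[of 0 N] v_c[of N 0] by linarith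
    show "real (m + n) - real (m + n) * v (m + n) \<le> real m - real m * v m + (real n - real n * v n)"
      for m n
    proof (cases "m + n = 0")
      case False
      have "real m * v m + real n * v n \<le> c M (m + n)" for M
        using v_c[of m M] v_c[of n "M + m"] by (simp add: c_add)
      then have "(real m * v m + real n * v n) / real (m + n) \<le> c M (m + n) / real (m + n)" for M
        by (intro divide_right_mono) auto
      then have "(real m * v m + real n * v n) / real (m + n) \<le> v (m + n)"
        unfolding v_def[of "m + n"] by (intro cINF_greatest) auto
      then have "real m * v m + real n * v n \<le> real (m + n) * v (m + n)"
        using False by (simp add: divide_le_eq mult.commute)
      then show ?thesis by simp
    qed simp
  qed
  then obtain L where L: "(\<lambda>N. (real N - real N * v N) / real N) \<longlonglongrightarrow> L"
    by (auto simp: convergent_def)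
  have "v \<longlonglongrightarrow> 1 - L"
  proof (rule Lim_transform_eventually)
    show "(\<lambda>N. 1 - (real N - real N * v N) / real N) \<longlonglongrightarrow> 1 - L"
      by (intro tendsto_diff tendsto_const L)
    show "eventually (\<lambda>N. 1 - (real N - real N * v N) / real N = v N) sequentially"
      by (intro eventually_sequentiallyI[of 1]) (simp add: field_simps)
  qed
  moreover have "eventually (\<lambda>N. 1 / (2 * real g) \<le> v N) sequentially"
  proof (rule eventually_sequentiallyI[of g])
    fix N assume N: "g \<le> N"
    have q: "real q \<le> c M (q * g)" for q M
    proof (induction q arbitrary: M)
      case (Suc q)
      obtain n where "n \<in> B" "M < n" "n \<le> M + g" using g by blast
      then have "B \<inter> {M + 1..M + g} \<noteq> {}" by auto
      then have "card (B \<inter> {M + 1..M + g}) \<ge> 1" by (simp add: Suc_le_eq card_gt_0_iff)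
      then have "1 \<le> c M g" by (simp add: c_def)
      then show ?case using Suc[of "M + g"] c_add[of M g "q * g"] by simp
    qed (simp add: c_def)
    \<comment> \<open>The factor 2 pays for rounding \<open>N\<close> down to a multiple of
      \<open>g\<close>.\<close>
    have "1 / (2 * real g) \<le> c M N / real N" for M
    proof -
      define q where "q = N div g"
      have N_eq: "N = q * g + N mod g" by (simp add: q_def)
      have "q \<ge> 1" using N gap by (simp add: q_def Suc_le_eq div_greater_zero_iff)
      then have "g \<le> q * g" by simp
      moreover have "N < q * g + g" using N_eq gap by (metis add_less_cancel_left mod_less_divisor)
      ultimately have "N \<le> 2 * (q * g)" by linarith
      then have "N \<le> q * (2 * g)" by (simp add: algebra_simps)
      then have "real N \<le> real q * (2 * real g)" by (metis of_nat_le_iff of_nat_mult of_nat_numeral)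
      also have "real q \<le> c M N"
        using q[of q M] c_add[of M "q * g" "N mod g"] c0[of "M + q * g" "N mod g"] N_eq by simp
      finally have "real N \<le> c M N * (2 * real g)" using gap by (simp add: mult_right_mono)
      then show ?thesis using N gap by (simp add: field_simps)
    qed
    then show "1 / (2 * real g) \<le> v N" unfolding v_def by (intro cINF_greatest) auto
  qed
  ultimately have "1 / (2 * real g) \<le> 1 - L"
    using tendsto_lowerbound[OF _ _ sequentially_bot] by blast
  moreover have "lower_Banach_density B = 1 - L"
    using limI[OF \<open>v \<longlonglongrightarrow> 1 - L\<close>] unfolding lower_Banach_density_def v_def c_def .
  ultimately show ?thesis using gap by (smt (verit) divide_pos_pos of_nat_0_less_iff)
qed

section \<open>The integer Cantor set\<close>

text \<open>Indexed by the number of digits, with level 0 equal to \<open>{0}\<close>, so that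
  levels add under concatenation of digit strings.\<close>

definition cantor_level :: "nat \<Rightarrow> nat set \<Rightarrow> nat \<Rightarrow> nat set" where
  "cantor_level b D N = {\<Sum>j<N. d j * b ^ j | d. \<forall>j<N. d j \<in> D}"

lemma cantor_levelI: "(\<And>j. j < N \<Longrightarrow> d j \<in> D) \<Longrightarrow> (\<Sum>j<N. d j * b ^ j) \<in> cantor_level b D N"
  unfolding cantor_level_def by blast

lemma cantor_level_add:
  assumes "c \<in> cantor_level b D M" "s \<in> cantor_level b D N"
  shows "b ^ N * c + s \<in> cantor_level b D (N + M)"
proof -
  obtain d e where d: "\<forall>j<M. d j \<in> D" "c = (\<Sum>j<M. d j * b ^ j)"
    and e: "\<forall>j<N. e j \<in> D" "s = (\<Sum>j<N. e j * b ^ j)"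
    using assms unfolding cantor_level_def by blast
  define f where "f j = (if j < N then e j else d (j - N))" for j
  have "(\<Sum>j<N + M. f j * b ^ j) = (\<Sum>j<N. f j * b ^ j) + (\<Sum>j<M. f (N + j) * b ^ (N + j))"
    by (induction M) (simp_all add: add.assoc)
  also have "\<dots> = b ^ N * c + s"
    by (simp add: f_def d e sum_distrib_left power_add mult_ac)
  finally show ?thesis
    using cantor_levelI[of "N + M" f D b] d(1) e(1) by (simp add: f_def)
qed

lemma cantor_level_split:
  assumes "u \<in> cantor_level b D (N + M)"
  obtains c s where "c \<in> cantor_level b D M" "s \<in> cantor_level b D N" "u = b ^ N * c + s"
proof -
  obtain d where d: "\<forall>j<N + M. d j \<in> D" "u = (\<Sum>j<N + M. d j * b ^ j)"
    using assms unfolding cantor_level_def by blast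
  have "u = (\<Sum>j<N. d j * b ^ j) + (\<Sum>j<M. d (N + j) * b ^ (N + j))"
    unfolding d(2) by (induction M) (simp_all add: add.assoc)
  also have "(\<Sum>j<M. d (N + j) * b ^ (N + j)) = b ^ N * (\<Sum>j<M. d (N + j) * b ^ j)"
    by (simp add: sum_distrib_left power_add mult_ac)
  finally have "u = b ^ N * (\<Sum>j<M. d (N + j) * b ^ j) + (\<Sum>j<N. d j * b ^ j)"
    by simp
  then show ?thesis
    using d(1) by (intro that[of "\<Sum>j<M. d (N + j) * b ^ j" "\<Sum>j<N. d j * b ^ j"] cantor_levelI) auto
qed

lemma zero_cantor_level: "0 \<in> D \<Longrightarrow> 0 \<in> cantor_level b D N"
  using cantor_levelI[of N "\<lambda>_. 0" D b] by simp

lemma cantor_level_mono: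
  assumes "0 \<in> D" "N \<le> M"
  shows "cantor_level b D N \<subseteq> cantor_level b D M"
proof
  fix s assume "s \<in> cantor_level b D N"
  from cantor_level_add[OF zero_cantor_level[OF assms(1), of b "M - N"] this] assms(2)
  show "s \<in> cantor_level b D M" by simp
qed

lemma cantor_level_less:
  assumes "D \<subseteq> {0..b - 1}" "b > 0" "s \<in> cantor_level b D N"
  shows "s < b ^ N"
proof -
  obtain d where d: "\<forall>j<N. d j \<in> D" "s = (\<Sum>j<N. d j * b ^ j)"
    using assms(3) unfolding cantor_level_def by blast
  have "(\<Sum>j<n. d j * b ^ j) < b ^ n" if "n \<le> N" for n
    using that
  proof (induction n)
    case (Suc n)
    have "d n \<in> D" using d(1) Suc.prems by simp
    then have "d n \<in> {0..b - 1}" using assms(1) by blast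
    then have "d n + 1 \<le> b" using assms(2) by simp
    then have "(d n + 1) * b ^ n \<le> b * b ^ n" by (rule mult_right_mono) simp
    then show ?case using Suc by simp
  qed simp
  then show ?thesis using d(2) by simp
qed

lemma integer_cantor_set_eq_levels:
  assumes "0 \<in> D"
  shows "integer_cantor_set b D = (\<Union>N. cantor_level b D N)"
proof
  show "integer_cantor_set b D \<subseteq> (\<Union>N. cantor_level b D N)"
  proof
    fix u assume "u \<in> integer_cantor_set b D"
    then obtain k d where "\<forall>j\<le>k. d j \<in> D" "u = (\<Sum>j\<le>k. d j * b ^ j)"
      unfolding integer_cantor_set_def by blast
    then have "u \<in> cantor_level b D (Suc k)"
      using cantor_levelI[of "Suc k" d D b] by (simp add: less_Suc_eq_le lessThan_Suc_atMost)
    then show "u \<in> (\<Union>N. cantor_level b D N)" by blast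
  qed
  show "(\<Union>N. cantor_level b D N) \<subseteq> integer_cantor_set b D"
  proof
    fix u assume "u \<in> (\<Union>N. cantor_level b D N)"
    then obtain N where "u \<in> cantor_level b D N" by blast
    \<comment> \<open>Elements of \<open>integer_cantor_set\<close> have at least one digit; a
      leading zero provides it when \<open>N = 0\<close>.\<close>
    then have "u \<in> cantor_level b D (Suc N)" using cantor_level_mono[OF assms, of N "Suc N"] by auto
    then show "u \<in> integer_cantor_set b D"
      unfolding cantor_level_def integer_cantor_set_def lessThan_Suc_atMost less_Suc_eq_le by blast
  qed
qed

text \<open>If some \<open>b\<^sup>N c\<^sub>N + cantor_level b D N\<close> missed \<open>G\<close> for every \<open>N\<close>, then along a sparse sequence of
  levels the numbers \<open>b\<^sup>N c\<^sub>N\<close> would have disjoint digit supports, and every finite sum of them would lie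
  in the translate belonging to its largest summand.\<close>

lemma ip_star_meets_translates:
  assumes D: "0 \<in> D"
    and G: "\<And>x :: nat \<Rightarrow> nat. \<exists>S. finite S \<and> S \<noteq> {} \<and> (\<Sum>j\<in>S. x j) \<in> G"
  obtains N where "\<And>c. c \<in> integer_cantor_set b D \<Longrightarrow> \<exists>s\<in>cantor_level b D N. b ^ N * c + s \<in> G"
proof (rule ccontr)
  assume "\<not> thesis"
  then have "\<exists>c h. c \<in> cantor_level b D h \<and> (\<forall>s\<in>cantor_level b D N. b ^ N * c + s \<notin> G)" for N
    using that[of N] unfolding integer_cantor_set_eq_levels[OF D] by blast
  then obtain c h where c: "\<And>N. c N \<in> cantor_level b D (h N)"
    "\<And>N s. s \<in> cantor_level b D N \<Longrightarrow> b ^ N * c N + s \<notin> G"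
    by metis
  \<comment> \<open>\<open>c N\<close> has \<open>h N\<close> digits, so the next level starts just
    above the digits of \<open>b ^ N * c N\<close>.\<close>
  define L where "L = rec_nat 0 (\<lambda>_ N. N + h N)"
  have L_Suc: "L (Suc i) = L i + h (L i)" for i by (simp add: L_def)
  define x where "x i = b ^ L i * c (L i)" for i
  obtain S where S: "finite S" "S \<noteq> {}" "(\<Sum>j\<in>S. x j) \<in> G" using G by blast
  have part: "(\<Sum>j\<in>S \<inter> {..<i}. x j) \<in> cantor_level b D (L i)" for i
  proof (induction i)
    case 0
    show ?case by (simp add: zero_cantor_level[OF D])
  next
    case (Suc i)
    show ?case
    proof (cases "i \<in> S")
      case True
      then have "S \<inter> {..<Suc i} = insert i (S \<inter> {..<i})" by auto
      then have "(\<Sum>j\<in>S \<inter> {..<Suc i}. x j) = b ^ L i * c (L i) + (\<Sum>j\<in>S \<inter> {..<i}. x j)"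
        by (simp add: x_def)
      then show ?thesis using cantor_level_add[OF c(1) Suc] unfolding L_Suc by simp
    next
      case False
      then have "S \<inter> {..<Suc i} = S \<inter> {..<i}" by (auto simp: less_Suc_eq)
      then show ?thesis using Suc cantor_level_mono[OF D, of "L i" "L (Suc i)"] by (auto simp: L_Suc)
    qed
  qed
  define i where "i = Max S"
  have "S = insert i (S \<inter> {..<i})"
    unfolding i_def using Max_in[OF S(1,2)] Max_ge[OF S(1)] by (fastforce simp: order.order_iff_strict)
  then have "(\<Sum>j\<in>S. x j) = b ^ L i * c (L i) + (\<Sum>j\<in>S \<inter> {..<i}. x j)"
    using S(1) by (metis (no_types, lifting) IntE finite_Int lessThan_iff less_irrefl sum.insert x_def)
  then show False using c(2)[OF part] S(3) by simp
qed

text \<open>The elements sharing a high part \<open>c\<close> form a block of consecutive indices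
  with at most \<open>card Q\<close> members. The block after the one containing \<open>k M\<close>
  meets \<open>G\<close>, so the wait from \<open>M\<close> is at most two blocks.\<close>

lemma syndetic_index:
  fixes k :: "nat \<Rightarrow> nat"
  assumes b: "b > 0" and D: "D \<subseteq> {0..b - 1}" "0 \<in> D"
    and mono: "strict_mono_on {1..} k" and range: "k ` {1..} = integer_cantor_set b D"
    and meets: "\<And>c. c \<in> integer_cantor_set b D \<Longrightarrow> \<exists>s\<in>cantor_level b D N. b ^ N * c + s \<in> G"
  shows "\<exists>g. \<forall>M. \<exists>n. M < n \<and> n \<le> M + g \<and> k n \<in> G"
proof -
  define C where "C = integer_cantor_set b D"
  define Q where "Q = cantor_level b D N"
  have less: "s < b ^ N" if "s \<in> Q" for s
    using cantor_level_less[OF D(1) b] that unfolding Q_def .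
  have "finite Q" by (rule finite_subset[of _ "{..<b ^ N}"]) (use less in auto)
  have join: "b ^ N * c + s \<in> C" if "c \<in> C" "s \<in> Q" for c s
    using that cantor_level_add[of c b D _ s N]
    unfolding C_def Q_def integer_cantor_set_eq_levels[OF D(2)] by blast
  have split: "\<exists>c\<in>C. \<exists>s\<in>Q. u = b ^ N * c + s" if "u \<in> C" for u
  proof -
    obtain L where "u \<in> cantor_level b D L"
      using \<open>u \<in> C\<close> unfolding C_def integer_cantor_set_eq_levels[OF D(2)] by blast
    then have "u \<in> cantor_level b D (N + L)"
      using cantor_level_mono[OF D(2), of L "N + L"] by auto
    then obtain c s where "c \<in> cantor_level b D L" "s \<in> Q" "u = b ^ N * c + s"
      unfolding Q_def by (rule cantor_level_split)
    then show ?thesis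
      unfolding C_def integer_cantor_set_eq_levels[OF D(2)] by blast
  qed
  have kC: "k n \<in> C" if "n \<ge> 1" for n using range that unfolding C_def by auto
  have k_less: "k i < k j \<longleftrightarrow> i < j" if "i \<ge> 1" "j \<ge> 1" for i j
    using strict_mono_on_less[OF mono, of i j] that by simp
  have step: "\<exists>n. M < n \<and> n \<le> M + 2 * card Q \<and> k n \<in> G" if M: "M \<ge> 1" for M
  proof -
    obtain c s where c: "c \<in> C" "s \<in> Q" "k M = b ^ N * c + s" using split[OF kC[OF M]] by blast
    \<comment> \<open>High parts are again elements of the Cantor set, so \<open>k\<close>
      enumerates the blocks as well and the next one lies over \<open>k (Suc i)\<close>.\<close>
    obtain i where i: "i \<ge> 1" "c = k i" using c(1) range unfolding C_def by force
    define c' where "c' = k (Suc i)"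
    have c': "c' \<in> C" "c < c'" using kC k_less i by (auto simp: c'_def)
    obtain s' where s': "s' \<in> Q" "b ^ N * c' + s' \<in> G"
      using meets c'(1) unfolding C_def Q_def by blast
    obtain n where n: "n \<ge> 1" "k n = b ^ N * c' + s'"
      using join[OF c'(1) s'(1)] range unfolding C_def by force
    have block: "u < v" if "b ^ N * u + r < b ^ N * v" for u v r :: nat
      using that b by (metis add_lessD1 mult_less_cancel1)
    have lt_mult: "b ^ N * u + r < b ^ N * v" if "u < v" "r \<in> Q" for u v r
    proof -
      have "b ^ N * u + r < b ^ N * Suc u" using less[OF that(2)] by simp
      also have "\<dots> \<le> b ^ N * v" using that(1) by (intro mult_left_mono) auto
      finally show ?thesis .
    qed
    have "k M < k n" using lt_mult[OF c'(2) c(2)] unfolding c(3) n(2) by linarith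
    then have Mn: "M < n" using k_less M n(1) by blast
    have "k ` {M<..n} \<subseteq> (\<lambda>(a, r). b ^ N * a + r) ` ({c, c'} \<times> Q)"
    proof
      fix u assume "u \<in> k ` {M<..n}"
      then obtain j where j: "M < j" "j \<le> n" "u = k j" by auto
      have "j \<ge> 1" using j(1) by simp
      obtain a r where a: "a \<in> C" "r \<in> Q" "k j = b ^ N * a + r"
        using split[OF kC[OF \<open>j \<ge> 1\<close>]] by blast
      have "k M < k j" using k_less j(1) M \<open>j \<ge> 1\<close> by blast
      have "k j \<le> k n" using k_less[OF n(1) \<open>j \<ge> 1\<close>] j(2) by linarith
      have "\<not> a < c" using lt_mult[of a c r] a(2,3) c(3) \<open>k M < k j\<close> by auto
      moreover have "\<not> c' < a" using lt_mult[of c' a s'] s'(1) a(3) n(2) \<open>k j \<le> k n\<close> by auto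
      moreover obtain i' where i': "i' \<ge> 1" "a = k i'" using a(1) range unfolding C_def by force
      ultimately have "i \<le> i'" "i' \<le> Suc i"
        using k_less[OF i'(1) i(1)] k_less[of "Suc i" i'] i'(1) i(2) unfolding c'_def i'(2) by auto
      then have "a = c \<or> a = c'" unfolding c'_def i(2) i'(2) by (auto simp: le_Suc_eq)
      then show "u \<in> (\<lambda>(a, r). b ^ N * a + r) ` ({c, c'} \<times> Q)"
        using a(2,3) j(3) by auto
    qed
    then have "card (k ` {M<..n}) \<le> card ((\<lambda>(a, r). b ^ N * a + r) ` ({c, c'} \<times> Q))"
      using \<open>finite Q\<close> by (intro card_mono) auto
    also have "\<dots> \<le> card ({c, c'} \<times> Q)" using \<open>finite Q\<close> by (intro card_image_le) auto
    also have "\<dots> = 2 * card Q" using c'(2) by (simp add: card_cartesian_product)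
    also have "card (k ` {M<..n}) = n - M"
    proof -
      have "inj_on k {M<..n}"
        by (rule inj_on_subset[OF strict_mono_on_imp_inj_on[OF mono]]) auto
      then show ?thesis by (simp add: card_image)
    qed
    finally show ?thesis using Mn s'(2) n(2) by (intro exI[of _ n]) auto
  qed
  \<comment> \<open>The enumeration starts at index 1, so \<open>M = 0\<close> is reduced to
    \<open>M = 1\<close> at the cost of the extra 1.\<close>
  have "\<exists>n. M < n \<and> n \<le> M + (2 * card Q + 1) \<and> k n \<in> G" for M
  proof (cases "M = 0")
    case True
    obtain n where "1 < n" "n \<le> 1 + 2 * card Q" "k n \<in> G" using step[of 1] by auto
    then show ?thesis using True by (intro exI[of _ n]) auto
  next
    case False
    then obtain n where "M < n" "n \<le> M + 2 * card Q" "k n \<in> G" using step[of M] by auto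
    then show ?thesis by (intro exI[of _ n]) auto
  qed
  then show ?thesis by blast
qed

theorem mainTheorem2:
  fixes b l :: nat and D :: "nat set" and k :: "nat \<Rightarrow> nat"
  assumes "b \<ge> 3"
    and "D \<subseteq> {0..b - 1}" and "0 \<in> D" and "2 \<le> card D" and "card D < b"
    and "strict_mono_on {1..} k" and "k ` {1..} = integer_cantor_set b D"
    and "l \<ge> 1"
  shows "\<forall>A::int set. upper_Banach_density A > 0 \<longrightarrow>
    (\<exists>B::nat set. B \<subseteq> {1..} \<and> lower_Banach_density B > 0 \<and>
      (\<forall>n\<in>B. \<exists>a::int. \<forall>i\<le>l. a + int i * int (k n) \<in> A))"
proof (intro allI impI)
  fix A :: "int set" assume "upper_Banach_density A > 0"
  then obtain \<delta> where \<delta>: "\<delta> > 0"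
    "\<forall>N0. \<exists>N\<ge>N0. \<exists>M. \<delta> * real N \<le> real (card (A \<inter> {M + 1..M + int N}))"
    using upper_Banach_density_posD by blast
  define G where "G = {s :: nat. \<exists>a. \<forall>i\<le>l. a + int i * int s \<in> A}"
  have "\<exists>S. finite S \<and> S \<noteq> {} \<and> (\<Sum>j\<in>S. x j) \<in> G" for x :: "nat \<Rightarrow> nat"
    using ip_szemeredi[OF \<delta>, where x = x and l = l] unfolding G_def mem_Collect_eq by metis
  then obtain N where "\<And>c. c \<in> integer_cantor_set b D \<Longrightarrow> \<exists>s\<in>cantor_level b D N. b ^ N * c + s \<in> G"
    using ip_star_meets_translates[OF assms(3), of G b] by blast
  then obtain g where g: "\<forall>M. \<exists>n. M < n \<and> n \<le> M + g \<and> k n \<in> G"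
    using syndetic_index[OF _ assms(2,3,6,7), of N G] assms(1) by auto
  define B where "B = {n. n \<ge> 1 \<and> k n \<in> G}"
  have "\<exists>n\<in>B. M < n \<and> n \<le> M + g" for M
    using g[rule_format, of M] by (auto simp: B_def Suc_le_eq intro: order.strict_trans1)
  then have "lower_Banach_density B > 0" by (rule lower_Banach_density_pos)
  then show "\<exists>B::nat set. B \<subseteq> {1..} \<and> lower_Banach_density B > 0 \<and>
      (\<forall>n\<in>B. \<exists>a::int. \<forall>i\<le>l. a + int i * int (k n) \<in> A)"
    by (intro exI[of _ B]) (auto simp: B_def G_def)
qed

end
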